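(* Let $(A,p_l)$ be a Montel Fréchet algebra and let $n\in\mathbb{N}$. If $A$ is $(n+2)$-weakly amenable, then $A$ is $n$-weakly amenable.
   Context: All spaces are complex and $\mathbb{N}=\{1,2,\dots\}$. A Fréchet algebra $(A,p_l)$ is an algebra that is complete and Hausdorff for the topology generated by a separating, increasing sequence $(p_l)_{l\in\mathbb{N}}$ of submultiplicative seminorms. It is a Montel Fréchet algebra if its underlying locally convex space is a Montel space (Hausdorff, barrelled, and every closed bounded subset is compact). For a locally convex space $X$, $X^*$ is its continuous dual with the strong topology (uniform convergence on bounded subsets of $X$); $X^{(0)}=X$ and $X^{(n)}=(X^{(n-1)})^*$. If $X$ is a locally convex $A$-bimodule, then $X^*$ is an $A$-bimodule via $\langle a\cdot f,x\rangle=\langle f,x\cdot a\rangle$ and $\langle f\cdot a,x\rangle=\langle f,a\cdot x\rangle$; iterating, every $X^{(n)}$ is an $A$-bimodule. $A$ is a bimodule over itself by multiplication. A continuous derivation $D:A\to X$ is a continuous linear map with $D(ab)=a\cdot D(b)+D(a)\cdot b$ for all $a,b\in A$; it is inner if there is $x\in X$ with $D(a)=a\cdot x-x\cdot a$ for all $a\in A$. $A$ is $n$-weakly amenable if every continuous derivation $A\to A^{(n)}$ is inner. *)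

theory Defs
  imports "HOL-Analysis.Analysis"
begin

section \<open>Locally convex spaces and bimodules\<close>

text \<open>
  The carrier of a space is the \<^const>\<open>topspace\<close> of its topology. The records only carry data:
  for the spaces below the vector space and bimodule laws follow from those of the algebra.
\<close>

record 'v lcs =
  topo :: "'v topology"
  vadd :: "'v \<Rightarrow> 'v \<Rightarrow> 'v"
  vzero :: 'v
  vscale :: "complex \<Rightarrow> 'v \<Rightarrow> 'v"

record ('a, 'v) lcbimod = "'v lcs" +
  lact :: "'a \<Rightarrow> 'v \<Rightarrow> 'v"
  ract :: "'v \<Rightarrow> 'a \<Rightarrow> 'v"

definition absorbs :: "('v, 'm) lcs_scheme \<Rightarrow> 'v set \<Rightarrow> 'v set \<Rightarrow> bool" where
  "absorbs X U B \<longleftrightarrow> (\<exists>r>0. \<forall>c. r \<le> cmod c \<longrightarrow> B \<subseteq> vscale X c ` U)"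

definition lc_bounded :: "('v, 'm) lcs_scheme \<Rightarrow> 'v set \<Rightarrow> bool" where
  "lc_bounded X B \<longleftrightarrow> B \<subseteq> topspace (topo X) \<and>
     (\<forall>U. openin (topo X) U \<and> vzero X \<in> U \<longrightarrow> absorbs X U B)"

definition barrel :: "('v, 'm) lcs_scheme \<Rightarrow> 'v set \<Rightarrow> bool" where
  "barrel X T \<longleftrightarrow> closedin (topo X) T \<and>
     (\<forall>x\<in>T. \<forall>y\<in>T. \<forall>t::real. 0 \<le> t \<and> t \<le> 1 \<longrightarrow>
        vadd X (vscale X (of_real t) x) (vscale X (of_real (1 - t)) y) \<in> T) \<and>
     (\<forall>x\<in>T. \<forall>c. cmod c \<le> 1 \<longrightarrow> vscale X c x \<in> T) \<and>
     (\<forall>x\<in>topspace (topo X). absorbs X T {x})"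

definition barrelled :: "('v, 'm) lcs_scheme \<Rightarrow> bool" where
  "barrelled X \<longleftrightarrow> (\<forall>T. barrel X T \<longrightarrow> (\<exists>U. openin (topo X) U \<and> vzero X \<in> U \<and> U \<subseteq> T))"

definition montel :: "('v, 'm) lcs_scheme \<Rightarrow> bool" where
  "montel X \<longleftrightarrow> Hausdorff_space (topo X) \<and> barrelled X \<and>
     (\<forall>B. closedin (topo X) B \<and> lc_bounded X B \<longrightarrow> compactin (topo X) B)"

section \<open>The strong dual\<close>

text \<open>Functionals are made extensional so that equality of functionals is equality on the carrier.\<close>

definition dual_space :: "('v, 'm) lcs_scheme \<Rightarrow> ('v \<Rightarrow> complex) set" where
  "dual_space X = {f \<in> extensional (topspace (topo X)).
     (\<forall>x\<in>topspace (topo X). \<forall>y\<in>topspace (topo X). f (vadd X x y) = f x + f y) \<and>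
     (\<forall>c. \<forall>x\<in>topspace (topo X). f (vscale X c x) = c * f x) \<and>
     continuous_map (topo X) euclidean f}"

definition strong_open :: "('v, 'm) lcs_scheme \<Rightarrow> ('v \<Rightarrow> complex) set \<Rightarrow> bool" where
  "strong_open X W \<longleftrightarrow> W \<subseteq> dual_space X \<and>
     (\<forall>f\<in>W. \<exists>B e. lc_bounded X B \<and> 0 < e \<and>
        {g \<in> dual_space X. \<forall>x\<in>B. cmod (g x - f x) < e} \<subseteq> W)"

definition strong_dual :: "('a, 'v) lcbimod \<Rightarrow> ('a, 'v \<Rightarrow> complex) lcbimod" where
  "strong_dual X = (let S = topspace (topo X) in
    \<lparr> topo = topology (strong_open X),
      vadd = (\<lambda>f g. \<lambda>x\<in>S. f x + g x),
      vzero = (\<lambda>x\<in>S. 0),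
      vscale = (\<lambda>c f. \<lambda>x\<in>S. c * f x),
      lact = (\<lambda>a f. \<lambda>x\<in>S. f (ract X x a)),
      ract = (\<lambda>f a. \<lambda>x\<in>S. f (lact X a x)) \<rparr>)"

lemma absorbs_Un:
  assumes "absorbs X U B" "absorbs X U C"
  shows "absorbs X U (B \<union> C)"
proof -
  obtain r s where "0 < r" "\<And>c. r \<le> cmod c \<Longrightarrow> B \<subseteq> vscale X c ` U"
    and "0 < s" "\<And>c. s \<le> cmod c \<Longrightarrow> C \<subseteq> vscale X c ` U"
    using assms unfolding absorbs_def by blast
  then show ?thesis
    unfolding absorbs_def by (intro exI[of _ "max r s"]) auto
qed

lemma lc_bounded_Un: "lc_bounded X B \<Longrightarrow> lc_bounded X C \<Longrightarrow> lc_bounded X (B \<union> C)"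
  by (auto simp: lc_bounded_def intro: absorbs_Un)

lemma lc_bounded_empty: "lc_bounded X {}"
  by (auto simp: lc_bounded_def absorbs_def intro: exI[of _ 1])

lemma istopology_strong_open: "istopology (strong_open X)"
  unfolding istopology_def
proof (intro conjI allI impI)
  fix V W assume V: "strong_open X V" and W: "strong_open X W"
  show "strong_open X (V \<inter> W)"
    unfolding strong_open_def
  proof (intro conjI ballI)
    show "V \<inter> W \<subseteq> dual_space X" using V by (auto simp: strong_open_def)
    fix f assume f: "f \<in> V \<inter> W"
    obtain B d where B: "lc_bounded X B" "0 < d"
      "{g \<in> dual_space X. \<forall>x\<in>B. cmod (g x - f x) < d} \<subseteq> V"
      using V f unfolding strong_open_def by (meson IntD1)
    obtain C e where C: "lc_bounded X C" "0 < e"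
      "{g \<in> dual_space X. \<forall>x\<in>C. cmod (g x - f x) < e} \<subseteq> W"
      using W f unfolding strong_open_def by (meson IntD2)
    show "\<exists>B e. lc_bounded X B \<and> 0 < e \<and>
        {g \<in> dual_space X. \<forall>x\<in>B. cmod (g x - f x) < e} \<subseteq> V \<inter> W"
      using B C by (intro exI[of _ "B \<union> C"] exI[of _ "min d e"]) (auto simp: lc_bounded_Un)
  qed
next
  fix K assume K: "\<forall>W\<in>K. strong_open X W"
  show "strong_open X (\<Union>K)"
    unfolding strong_open_def
  proof (intro conjI ballI)
    show "\<Union>K \<subseteq> dual_space X" using K by (auto simp: strong_open_def)
    fix f assume "f \<in> \<Union>K"
    then obtain W where W: "W \<in> K" "f \<in> W" by blast
    then obtain B e where "lc_bounded X B" "0 < e"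
      "{g \<in> dual_space X. \<forall>x\<in>B. cmod (g x - f x) < e} \<subseteq> W"
      using K unfolding strong_open_def by meson
    with W show "\<exists>B e. lc_bounded X B \<and> 0 < e \<and>
        {g \<in> dual_space X. \<forall>x\<in>B. cmod (g x - f x) < e} \<subseteq> \<Union>K"
      by (intro exI[of _ B] exI[of _ e]) auto
  qed
qed

lemma openin_strong_dual: "openin (topo (strong_dual X)) = strong_open X"
  by (simp add: strong_dual_def Let_def istopology_strong_open topology_inverse')

lemma topspace_strong_dual: "topspace (topo (strong_dual X)) = dual_space X"
proof -
  have "strong_open X (dual_space X)"
    unfolding strong_open_def
    by (intro conjI ballI exI[of _ "{}"] exI[of _ 1]) (auto simp: lc_bounded_empty)
  moreover have "W \<subseteq> dual_space X" if "strong_open X W" for W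
    using that by (simp add: strong_open_def)
  ultimately show ?thesis
    unfolding topspace_def openin_strong_dual by blast
qed

section \<open>Iterated duals\<close>

text \<open>
  The literal iterated duals of a space over \<open>'a\<close> live in the pairwise different types \<open>'a\<close>,
  \<open>'a \<Rightarrow> complex\<close>, \<open>('a \<Rightarrow> complex) \<Rightarrow> complex\<close>, and so on. To speak about all of them for a variable
  \<open>n\<close>, each one is replaced by its isomorphic copy inside one ambient type \<open>'u\<close>, along maps
  \<open>j :: 'a \<Rightarrow> 'u\<close> and \<open>c k :: ('u \<Rightarrow> complex) \<Rightarrow> 'u\<close> that are injective on the relevant carriers
  (\<open>dual_coding\<close>). For each number \<open>N\<close> of duals there are such a type and such a coding (see
  the last section). For a general algebra the cardinalities of the duals may outgrow every type
  available in HOL, so that no single \<open>'u\<close> works for all \<open>N\<close>; hence \<open>'u\<close> is a type variable and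
  the coding a parameter. The notions below are invariant under isomorphism, so they do not
  depend on the choice of the coding.
\<close>

definition copy_along :: "('v \<Rightarrow> 'w) \<Rightarrow> ('a, 'v) lcbimod \<Rightarrow> ('a, 'w) lcbimod" where
  "copy_along h X = (let S = topspace (topo X); g = inv_into S h in
    \<lparr> topo = pullback_topology (h ` S) g (topo X),
      vadd = (\<lambda>u v. h (vadd X (g u) (g v))),
      vzero = h (vzero X),
      vscale = (\<lambda>z u. h (vscale X z (g u))),
      lact = (\<lambda>a u. h (lact X a (g u))),
      ract = (\<lambda>u a. h (ract X (g u) a)) \<rparr>)"

primrec iter_dual ::
  "('a \<Rightarrow> 'u) \<Rightarrow> (nat \<Rightarrow> ('u \<Rightarrow> complex) \<Rightarrow> 'u) \<Rightarrow> ('a, 'a) lcbimod \<Rightarrow> nat \<Rightarrow> ('a, 'u) lcbimod" where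
  "iter_dual j c A 0 = copy_along j A"
| "iter_dual j c A (Suc k) = copy_along (c k) (strong_dual (iter_dual j c A k))"

definition dual_coding ::
  "('a \<Rightarrow> 'u) \<Rightarrow> (nat \<Rightarrow> ('u \<Rightarrow> complex) \<Rightarrow> 'u) \<Rightarrow> ('a, 'a) lcbimod \<Rightarrow> nat \<Rightarrow> bool" where
  "dual_coding j c A N \<longleftrightarrow> inj_on j (topspace (topo A)) \<and>
     (\<forall>k<N. inj_on (c k) (dual_space (iter_dual j c A k)))"

section \<open>Frechet algebras and weak amenability\<close>

definition seminorm_topology :: "(nat \<Rightarrow> 'a::ab_group_add \<Rightarrow> real) \<Rightarrow> 'a topology" where
  "seminorm_topology p = topology_generated_by {{y. p l (y - x) < r} | l x r. 0 < r}"

definition seminorm_cauchy :: "(nat \<Rightarrow> 'a::ab_group_add \<Rightarrow> real) \<Rightarrow> 'a filter \<Rightarrow> bool" where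
  "seminorm_cauchy p F \<longleftrightarrow>
     (\<forall>l. \<forall>r>0. \<exists>M. eventually (\<lambda>x. x \<in> M) F \<and> (\<forall>x\<in>M. \<forall>y\<in>M. p l (x - y) < r))"

text \<open>The class \<^class>\<open>ring\<close> does not require a unit.\<close>

definition frechet_algebra ::
  "(complex \<Rightarrow> 'a \<Rightarrow> 'a) \<Rightarrow> (nat \<Rightarrow> 'a::ring \<Rightarrow> real) \<Rightarrow> bool" where
  "frechet_algebra s p \<longleftrightarrow>
     vector_space s \<and>
     (\<forall>c x y. s c (x * y) = s c x * y \<and> s c (x * y) = x * s c y) \<and>
     (\<forall>l x y. p l (x + y) \<le> p l x + p l y) \<and>
     (\<forall>l c x. p l (s c x) = cmod c * p l x) \<and>
     (\<forall>l x y. p l (x * y) \<le> p l x * p l y) \<and>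
     (\<forall>l x. p l x \<le> p (Suc l) x) \<and>
     (\<forall>x. (\<forall>l. p l x = 0) \<longrightarrow> x = 0) \<and>
     Hausdorff_space (seminorm_topology p) \<and>
     (\<forall>F. F \<noteq> bot \<and> seminorm_cauchy p F \<longrightarrow> (\<exists>x. limitin (seminorm_topology p) (\<lambda>y. y) x F))"

definition alg_bimod ::
  "(complex \<Rightarrow> 'a \<Rightarrow> 'a) \<Rightarrow> (nat \<Rightarrow> 'a::ring \<Rightarrow> real) \<Rightarrow> ('a, 'a) lcbimod" where
  "alg_bimod s p =
    \<lparr> topo = seminorm_topology p, vadd = (+), vzero = 0, vscale = s, lact = (*), ract = (*) \<rparr>"

definition continuous_derivation ::
  "('a::ring, 'a) lcbimod \<Rightarrow> ('a, 'v) lcbimod \<Rightarrow> ('a \<Rightarrow> 'v) \<Rightarrow> bool" where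
  "continuous_derivation A X D \<longleftrightarrow>
     continuous_map (topo A) (topo X) D \<and>
     (\<forall>a b. D (vadd A a b) = vadd X (D a) (D b)) \<and>
     (\<forall>c a. D (vscale A c a) = vscale X c (D a)) \<and>
     (\<forall>a b. D (a * b) = vadd X (lact X a (D b)) (ract X (D a) b))"

definition inner_derivation :: "('a, 'v) lcbimod \<Rightarrow> ('a \<Rightarrow> 'v) \<Rightarrow> bool" where
  "inner_derivation X D \<longleftrightarrow>
     (\<exists>x\<in>topspace (topo X). \<forall>a. D a = vadd X (lact X a x) (vscale X (-1) (ract X x a)))"

definition weakly_amenable ::
  "('a \<Rightarrow> 'u) \<Rightarrow> (nat \<Rightarrow> ('u \<Rightarrow> complex) \<Rightarrow> 'u) \<Rightarrow> nat \<Rightarrow> ('a::ring, 'a) lcbimod \<Rightarrow> bool" where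
  "weakly_amenable j c n A \<longleftrightarrow>
     (\<forall>D. continuous_derivation A (iter_dual j c A n) D \<longrightarrow> inner_derivation (iter_dual j c A n) D)"

section \<open>Existence of codings\<close>

text \<open>
  The hypothesis \<open>dual_coding\<close> is satisfiable for every number of duals: \<open>dual_coding_0\<close> and
  repeated use of \<open>dual_coding_Suc\<close>, which enlarges the ambient type from \<open>'u\<close> to
  \<open>'u + ('u \<Rightarrow> complex)\<close>, give a coding of \<open>N\<close> duals for each \<open>N\<close>.
\<close>

abbreviation carr :: "('v, 'm) lcs_scheme \<Rightarrow> 'v set" where
  "carr X \<equiv> topspace (topo X)"

definition lc_closed :: "('v,'m) lcs_scheme \<Rightarrow> bool" where
 "lc_closed X \<longleftrightarrow> vzero X \<in> carr X \<and> (\<forall>x\<in>carr X. \<forall>y\<in>carr X. vadd X x y \<in> carr X) \<and> (\<forall>c. \<forall>x\<in>carr X. vscale X c x \<in> carr X)"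

definition lc_iso :: "('v \<Rightarrow> 'w) \<Rightarrow> ('v,'m) lcs_scheme \<Rightarrow> ('w,'k) lcs_scheme \<Rightarrow> bool" where
 "lc_iso h X Y \<longleftrightarrow> lc_closed X \<and> homeomorphic_map (topo X) (topo Y) h \<and> h (vzero X) = vzero Y \<and>
   (\<forall>x\<in>carr X. \<forall>y\<in>carr X. h (vadd X x y) = vadd Y (h x) (h y)) \<and>
   (\<forall>c. \<forall>x\<in>carr X. h (vscale X c x) = vscale Y c (h x))"

lemma lc_iso_img: "lc_iso h X Y \<Longrightarrow> h ` carr X = carr Y" "lc_iso h X Y \<Longrightarrow> inj_on h (carr X)"
  by (auto simp: lc_iso_def homeomorphic_eq_everything_map)

lemma lc_iso_closed: assumes i: "lc_iso h X Y" shows "lc_closed Y"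
  unfolding lc_closed_def lc_iso_img(1)[OF i, symmetric]
proof (intro conjI ballI allI)
  have c: "lc_closed X" using i by (simp add: lc_iso_def)
  show "vzero Y \<in> h ` carr X" using i c unfolding lc_iso_def lc_closed_def by (metis imageI)
  fix u v assume "u \<in> h ` carr X" "v \<in> h ` carr X"
  then obtain x y where x: "u = h x" "x \<in> carr X" "v = h y" "y \<in> carr X" by blast
  then have "vadd Y u v = h (vadd X x y)" using i by (simp add: lc_iso_def)
  then show "vadd Y u v \<in> h ` carr X" using x c by (simp add: lc_closed_def)
next
  have c: "lc_closed X" using i by (simp add: lc_iso_def)
  fix z u assume "u \<in> h ` carr X" 
  then obtain x where x: "u = h x" "x \<in> carr X" by blast
  then have "vscale Y z u = h (vscale X z x)" using i by (simp add: lc_iso_def)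
  then show "vscale Y z u \<in> h ` carr X" using x c by (simp add: lc_closed_def)
qed

lemma lc_iso_factor:
  assumes u: "lc_iso u Z X" and v: "lc_iso v Z Y" and f: "\<And>z. z \<in> carr Z \<Longrightarrow> v z = h (u z)"
  shows "lc_iso h X Y"
proof -
  obtain u' where u': "homeomorphic_maps (topo Z) (topo X) u u'"
    using u by (auto simp: lc_iso_def homeomorphic_map_maps)
  then have "homeomorphic_map (topo X) (topo Z) u'"
    by (simp add: homeomorphic_maps_map)
  then have "homeomorphic_map (topo X) (topo Y) (v \<circ> u')"
    using v homeomorphic_map_compose by (auto simp: lc_iso_def)
  moreover have "(v \<circ> u') x = h x" if "x \<in> carr X" for x
  proof -
    have "u' x \<in> carr Z" "u (u' x) = x" using u' that
      by (auto simp: homeomorphic_maps_def continuous_map_def)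
    then show ?thesis by (simp add: f)
  qed
  ultimately have hm: "homeomorphic_map (topo X) (topo Y) h"
    using homeomorphic_map_eq by metis
  have cZ: "lc_closed Z" using u by (simp add: lc_iso_def)
  have im: "carr X = u ` carr Z" using lc_iso_img(1)[OF u] by simp
  have 1: "h (vzero X) = vzero Y"
    using u v f cZ unfolding lc_iso_def lc_closed_def by metis
  have 2: "h (vadd X (u x) (u y)) = vadd Y (h (u x)) (h (u y))" if "x \<in> carr Z" "y \<in> carr Z" for x y
    using u v f[OF that(1)] f[OF that(2)] f[of "vadd Z x y"] cZ that unfolding lc_iso_def lc_closed_def by metis
  have 3: "h (vscale X c (u x)) = vscale Y c (h (u x))" if "x \<in> carr Z" for x c
    using u v f[OF that(1)] f[of "vscale Z c x"] cZ that unfolding lc_iso_def lc_closed_def by metis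
  show ?thesis unfolding lc_iso_def using lc_iso_closed[OF u] hm 1 2 3 by (auto simp: im)
qed

lemma lc_iso_copy_along: assumes "lc_closed X" "inj_on h (carr X)"
  shows "lc_iso h X (copy_along h X)"
proof -
  let ?g = "inv_into (carr X) h"
  let ?T = "topo (copy_along h X)"
  have T: "?T = pullback_topology (h ` carr X) ?g (topo X)" by (simp add: copy_along_def Let_def)
  have g: "?g (h x) = x" if "x \<in> carr X" for x using assms that by simp
  have ts: "topspace ?T = h ` carr X" unfolding T topspace_pullback_topology
    using g by auto
  have "homeomorphic_maps (topo X) ?T h ?g"
    unfolding homeomorphic_maps_def
  proof (intro conjI ballI)
    show "continuous_map (topo X) ?T h" unfolding T
    proof (rule continuous_map_pullback')
      show "continuous_map (topo X) (topo X) (?g \<circ> h)"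
        by (rule continuous_map_eq[of _ _ id]) (auto simp: g)
    qed auto
    show "continuous_map ?T (topo X) ?g" unfolding T
      using continuous_map_pullback[OF continuous_map_id, of "h ` carr X" ?g "topo X"] by simp
  qed (auto simp: ts g)
  then have "homeomorphic_map (topo X) ?T h" by (auto simp: homeomorphic_map_maps)
  then show ?thesis unfolding lc_iso_def using assms g by (simp add: copy_along_def Let_def lc_closed_def)
qed

lemma lc_iso_absorbs:
  assumes i: "lc_iso h X Y" and U: "U \<subseteq> carr X" and B: "B \<subseteq> carr X"
  shows "absorbs Y (h ` U) (h ` B) \<longleftrightarrow> absorbs X U B"
proof -
  have "vscale Y c ` h ` U = h ` vscale X c ` U" for c
    using i U unfolding image_image lc_iso_def by (intro image_cong) auto
  moreover have "vscale X c ` U \<subseteq> carr X" for c using i U by (auto simp: lc_iso_def lc_closed_def)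
  ultimately show ?thesis unfolding absorbs_def 
    using inj_on_image_subset_iff[OF lc_iso_img(2)[OF i]] B by auto
qed

lemma lc_iso_bounded: assumes i: "lc_iso h X Y" and b: "B \<subseteq> carr X"
  shows "lc_bounded Y (h ` B) \<longleftrightarrow> lc_bounded X B"
proof -
  have hm: "homeomorphic_map (topo X) (topo Y) h" using i by (simp add: lc_iso_def)
  have op: "openin (topo Y) (h ` U) \<longleftrightarrow> openin (topo X) U" if "U \<subseteq> carr X" for U
    using homeomorphic_map_openness[OF hm that] .
  have z: "vzero Y \<in> h ` U \<longleftrightarrow> vzero X \<in> U" if "U \<subseteq> carr X" for U
    using i that lc_iso_img(2)[OF i] inj_on_image_mem_iff[of h "carr X" "vzero X" U] by (auto simp: lc_iso_def lc_closed_def)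
  have ex: "\<exists>U. U \<subseteq> carr X \<and> V = h ` U" if "openin (topo Y) V" for V
    using openin_subset[OF that] lc_iso_img(1)[OF i] by (metis subset_imageE)
  have sub: "h ` B \<subseteq> carr Y" using b lc_iso_img(1)[OF i] by auto
  show ?thesis
  proof
    assume L: "lc_bounded Y (h ` B)"
    show "lc_bounded X B" unfolding lc_bounded_def
    proof (intro conjI allI impI)
      fix U assume U: "openin (topo X) U \<and> vzero X \<in> U"
      then have s: "U \<subseteq> carr X" using openin_subset by blast
      have "openin (topo Y) (h ` U) \<and> vzero Y \<in> h ` U" using U op[OF s] z[OF s] by simp
      then have "absorbs Y (h ` U) (h ` B)"
        using L[unfolded lc_bounded_def, THEN conjunct2, rule_format] by blast
      then show "absorbs X U B" using lc_iso_absorbs[OF i s b] by blast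
    qed (rule b)
  next
    assume R: "lc_bounded X B"
    show "lc_bounded Y (h ` B)" unfolding lc_bounded_def
    proof (intro conjI allI impI)
      fix V assume V: "openin (topo Y) V \<and> vzero Y \<in> V"
      then obtain U where s: "U \<subseteq> carr X" "V = h ` U" using ex by blast
      have "openin (topo X) U \<and> vzero X \<in> U" using V s(2) op[OF s(1)] z[OF s(1)] by simp
      then have "absorbs X U B"
        using R[unfolded lc_bounded_def, THEN conjunct2, rule_format] by blast
      then show "absorbs Y V (h ` B)" using lc_iso_absorbs[OF i s(1) b] s by simp
    qed (rule sub)
  qed
qed

lemma lc_closed_strong_dual: assumes c: "lc_closed X" shows "lc_closed (strong_dual X)"
proof -
  have 1: "(\<lambda>x\<in>carr X. 0) \<in> dual_space X"
    using c unfolding dual_space_def lc_closed_def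
    by (auto intro: continuous_map_eq[of _ _ "\<lambda>x. 0"])
  have 2: "(\<lambda>x\<in>carr X. f x + g x) \<in> dual_space X" if "f \<in> dual_space X" "g \<in> dual_space X" for f g
  proof -
    have "continuous_map (topo X) euclidean (\<lambda>x. f x + g x)"
      using that unfolding dual_space_def by (auto intro: continuous_intros)
    then have "continuous_map (topo X) euclidean (\<lambda>x\<in>carr X. f x + g x)"
      by (rule continuous_map_eq) auto
    then show ?thesis using that c unfolding dual_space_def lc_closed_def by (auto simp: algebra_simps)
  qed
  have 3: "(\<lambda>x\<in>carr X. z * f x) \<in> dual_space X" if "f \<in> dual_space X" for f z
  proof -
    have "continuous_map (topo X) euclidean (\<lambda>x. z * f x)"
      using that unfolding dual_space_def
      by (auto intro: continuous_map_compose[of _ euclidean f _ "\<lambda>w. z * w", unfolded o_def] continuous_intros)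
    then have "continuous_map (topo X) euclidean (\<lambda>x\<in>carr X. z * f x)"
      by (rule continuous_map_eq) auto
    then show ?thesis using that c unfolding dual_space_def lc_closed_def by (auto simp: algebra_simps)
  qed
  show ?thesis unfolding lc_closed_def topspace_strong_dual using 1 2 3
    by (auto simp: strong_dual_def Let_def)
qed

lemma dual_space_pullback: assumes i: "lc_iso h X Y" and f: "f \<in> dual_space Y"
  shows "(\<lambda>x\<in>carr X. f (h x)) \<in> dual_space X"
proof -
  have h: "h x \<in> carr Y" if "x \<in> carr X" for x using lc_iso_img(1)[OF i] that by auto
  have "continuous_map (topo X) (topo Y) h"
    using i by (simp add: lc_iso_def homeomorphic_eq_everything_map)
  then have "continuous_map (topo X) euclidean (f \<circ> h)"
    using f continuous_map_compose by (auto simp: dual_space_def)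
  then have "continuous_map (topo X) euclidean (\<lambda>x\<in>carr X. f (h x))"
    by (rule continuous_map_eq) auto
  then show ?thesis using i f h unfolding dual_space_def lc_iso_def lc_closed_def by auto
qed

lemma lc_iso_inv: assumes i: "lc_iso h X Y" shows "lc_iso (inv_into (carr X) h) Y X"
proof -
  have "lc_iso id X X" using i unfolding lc_iso_def by auto
  then show ?thesis by (rule lc_iso_factor[OF i]) (simp add: lc_iso_img(2)[OF i])
qed

lemma continuous_strong_dual_pullback:
 fixes X' :: "('a,'f) lcbimod" and Y' :: "('a,'g) lcbimod"
 assumes k: "lc_iso k X' Y'"
 shows "continuous_map (topo (strong_dual Y')) (topo (strong_dual X')) (\<lambda>f. \<lambda>x\<in>carr X'. f (k x))"
  proof -
    let ?H = "\<lambda>f. \<lambda>x\<in>carr X'. f (k x)"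
    have "strong_open Y' {f \<in> dual_space Y'. ?H f \<in> W}" if W: "strong_open X' W" for W
      unfolding strong_open_def
    proof (intro conjI ballI)
      fix f assume f: "f \<in> {f \<in> dual_space Y'. ?H f \<in> W}"
      then obtain B e where B: "lc_bounded X' B" "0 < e"
        "{g \<in> dual_space X'. \<forall>x\<in>B. cmod (g x - ?H f x) < e} \<subseteq> W"
        using W unfolding strong_open_def by blast
      have s: "B \<subseteq> carr X'" using B by (simp add: lc_bounded_def)
      then have "lc_bounded Y' (k ` B)" using lc_iso_bounded[OF k s] B by simp
      moreover have "{g \<in> dual_space Y'. \<forall>x\<in>k ` B. cmod (g x - f x) < e} \<subseteq> {f \<in> dual_space Y'. ?H f \<in> W}"
      proof safe
        fix g assume g: "g \<in> dual_space Y'" "\<forall>x\<in>k ` B. cmod (g x - f x) < e"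
        have "?H g \<in> {g \<in> dual_space X'. \<forall>x\<in>B. cmod (g x - ?H f x) < e}"
          using dual_space_pullback[OF k g(1)] g(2) s by auto
        with B show "?H g \<in> W" by blast
      qed
      ultimately show "\<exists>B e. lc_bounded Y' B \<and> 0 < e \<and> {g \<in> dual_space Y'. \<forall>x\<in>B. cmod (g x - f x) < e} \<subseteq> {f \<in> dual_space Y'. ?H f \<in> W}"
        using B(2) by blast
    qed auto
    then show ?thesis using dual_space_pullback[OF k]
      unfolding continuous_map_def topspace_strong_dual openin_strong_dual by blast
  qed

lemma dual_space_extensional: "f \<in> dual_space Z \<Longrightarrow> f \<in> extensional (carr Z)" by (simp add: dual_space_def)

lemma lc_iso_strong_dual: fixes X :: "('a,'f) lcbimod" and Y :: "('a,'g) lcbimod" assumes i: "lc_iso h X Y"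
  shows "lc_iso (\<lambda>f. \<lambda>x\<in>carr X. f (h x)) (strong_dual Y) (strong_dual X)"
proof -
  let ?g = "inv_into (carr X) h"
  have j: "lc_iso ?g Y X" by (rule lc_iso_inv[OF i])
  have hg: "h (?g y) = y" "?g y \<in> carr X" if "y \<in> carr Y" for y
    using lc_iso_img(1)[OF i] that by (auto simp: f_inv_into_f inv_into_into)
  have gh: "?g (h x) = x" "h x \<in> carr Y" if "x \<in> carr X" for x
    using lc_iso_img[OF i] that by (auto simp: f_inv_into_f inv_into_into)
  have "homeomorphic_maps (topo (strong_dual Y)) (topo (strong_dual X))
     (\<lambda>f. \<lambda>x\<in>carr X. f (h x)) (\<lambda>f. \<lambda>x\<in>carr Y. f (?g x))"
    unfolding homeomorphic_maps_def topspace_strong_dual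
  proof (intro conjI ballI)
    fix f assume f: "f \<in> dual_space Y"
    show "(\<lambda>y\<in>carr Y. (\<lambda>x\<in>carr X. f (h x)) (?g y)) = f"
      using dual_space_extensional[OF f] hg by (auto simp: fun_eq_iff extensional_def restrict_def)
  next
    fix f assume f: "f \<in> dual_space X"
    show "(\<lambda>x\<in>carr X. (\<lambda>y\<in>carr Y. f (?g y)) (h x)) = f"
      using dual_space_extensional[OF f] gh by (auto simp: fun_eq_iff extensional_def restrict_def)
  qed (use continuous_strong_dual_pullback[OF i] continuous_strong_dual_pullback[OF j] in auto)
  then have hm: "homeomorphic_map (topo (strong_dual Y)) (topo (strong_dual X)) (\<lambda>f. \<lambda>x\<in>carr X. f (h x))"
    by (auto simp: homeomorphic_map_maps)
  have "lc_closed (strong_dual Y)" by (rule lc_closed_strong_dual[OF lc_iso_closed[OF i]])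
  with hm show ?thesis unfolding lc_iso_def
    by (auto simp: strong_dual_def Let_def gh intro!: ext)
qed

lemma dual_coding_0: "dual_coding id c A 0" by (simp add: dual_coding_def)

lemma dual_coding_Suc:
  assumes A: "lc_closed A" and d: "dual_coding j c A N"
  shows "\<exists>c'. dual_coding (Inl \<circ> j :: 'a \<Rightarrow> 'u + ('u \<Rightarrow> complex)) c' A (Suc N)"
proof -
  let ?X = "iter_dual j c A"
  define c' :: "nat \<Rightarrow> ('u + ('u \<Rightarrow> complex) \<Rightarrow> complex) \<Rightarrow> 'u + ('u \<Rightarrow> complex)" where "c' = (\<lambda>k f. let r = (\<lambda>x\<in>carr (?X k). f (Inl x)) in if k < N then Inl (c k r) else Inr r)"
  let ?X' = "iter_dual (Inl \<circ> j :: 'a \<Rightarrow> 'u + ('u \<Rightarrow> complex)) c' A"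
  have jj: "inj_on j (carr A)" using d by (simp add: dual_coding_def)
  then have jj': "inj_on (Inl \<circ> j) (carr A)" by (simp add: comp_inj_on)
  have I: "lc_iso Inl (?X k) (?X' k)" if "k \<le> N" for k using that
  proof (induction k)
    case 0
    show ?case unfolding iter_dual.simps by (rule lc_iso_factor[OF lc_iso_copy_along[OF A jj] lc_iso_copy_along[OF A jj']]) simp
  next
    case (Suc k)
    let ?H = "\<lambda>f. \<lambda>x\<in>carr (?X k). f (Inl x)"
    have IH: "lc_iso ?H (strong_dual (?X' k)) (strong_dual (?X k))"
      by (rule lc_iso_strong_dual, rule Suc.IH) (use Suc.prems in simp)
    have ci: "inj_on (c k) (carr (strong_dual (?X k)))"
      using d Suc.prems by (simp add: dual_coding_def topspace_strong_dual)
    have cp: "lc_iso (c k) (strong_dual (?X k)) (?X (Suc k))"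
      using lc_iso_copy_along[OF lc_iso_closed[OF IH] ci] by simp
    have ci': "inj_on (c' k) (carr (strong_dual (?X' k)))"
    proof (rule inj_onI)
      fix f g assume fg: "f \<in> carr (strong_dual (?X' k))" "g \<in> carr (strong_dual (?X' k))" "c' k f = c' k g"
      then have "c k (?H f) = c k (?H g)" using Suc.prems by (simp add: c'_def Let_def)
      moreover have "?H f \<in> carr (strong_dual (?X k))" "?H g \<in> carr (strong_dual (?X k))" 
        using lc_iso_img(1)[OF IH] fg by blast+
      ultimately have "?H f = ?H g" using ci by (meson inj_onD)
      then show "f = g" using inj_onD[OF lc_iso_img(2)[OF IH] _ fg(1,2)] by simp
    qed
    have cp': "lc_iso (c' k) (strong_dual (?X' k)) (?X' (Suc k))"
      using lc_iso_copy_along[OF _ ci'] IH by (simp add: lc_iso_def)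
    have H: "lc_iso (inv_into (carr (strong_dual (?X' k))) ?H) (strong_dual (?X k)) (strong_dual (?X' k))" 
      by (rule lc_iso_inv[OF IH])
    let ?G = "inv_into (carr (strong_dual (?X' k))) ?H"
    have "lc_iso (c' k \<circ> ?G) (strong_dual (?X k)) (?X' (Suc k))"
    proof (rule lc_iso_factor[OF IH cp'])
      fix z assume "z \<in> carr (strong_dual (?X' k))"
      then have "?G (?H z) = z" by (rule inv_into_f_f[OF lc_iso_img(2)[OF IH]])
      then show "c' k z = (c' k \<circ> ?G) (?H z)" by simp
    qed
    then show ?case
    proof (rule lc_iso_factor[OF cp])
      fix z assume z: "z \<in> carr (strong_dual (?X k))"
      have "z \<in> ?H ` carr (strong_dual (?X' k))" using z lc_iso_img(1)[OF IH] by simp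
      then have "?H (?G z) = z" by (rule f_inv_into_f[where f = ?H])
      then show "(c' k \<circ> ?G) z = Inl (c k z)" using Suc.prems by (simp add: c'_def Let_def)
    qed
  qed
  have "inj_on (c' k) (dual_space (?X' k))" if "k < Suc N" for k
  proof -
    let ?H = "\<lambda>f. \<lambda>x\<in>carr (?X k). f (Inl x)"
    have IH: "lc_iso ?H (strong_dual (?X' k)) (strong_dual (?X k))"
      by (rule lc_iso_strong_dual, rule I) (use that in simp)
    show ?thesis
    proof (rule inj_onI)
      fix f g assume fg: "f \<in> dual_space (?X' k)" "g \<in> dual_space (?X' k)" "c' k f = c' k g"
      have m: "?H f \<in> dual_space (?X k)" "?H g \<in> dual_space (?X k)" 
        using lc_iso_img(1)[OF IH] fg unfolding topspace_strong_dual by blast+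
      have "?H f = ?H g"
      proof (cases "k < N")
        case True
        then have "inj_on (c k) (dual_space (?X k))" using d by (simp add: dual_coding_def)
        then show ?thesis using True fg(3) m by (simp add: c'_def Let_def inj_on_def)
      next
        case False then show ?thesis using fg(3) by (simp add: c'_def Let_def)
      qed
      then show "f = g" using inj_onD[OF lc_iso_img(2)[OF IH]] fg by (simp add: topspace_strong_dual)
    qed
  qed
  then have "dual_coding (Inl \<circ> j) c' A (Suc N)"
    unfolding dual_coding_def using jj' by blast
  then show ?thesis by - (rule exI[of _ c'])
qed

lemma lc_closed_alg_bimod: assumes "frechet_algebra s p" shows "lc_closed (alg_bimod s p)"
proof -
  have vs: "vector_space s"
    using assms unfolding frechet_algebra_def by (elim conjE)
  have hom: "\<forall>l c x. p l (s c x) = cmod c * p l x"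
    using assms unfolding frechet_algebra_def by (elim conjE)
  have "s 0 0 = 0"
    using vs by (simp add: module.scale_zero_left module_iff_vector_space)
  then have p0: "p l 0 = 0" for l using spec[OF spec[OF spec[OF hom, of l], of 0], of 0] by simp
  have mem: "x \<in> {y. p 0 (y - x) < 1}" for x using p0 by simp
  have "{y. p 0 (y - x) < 1} \<in> {{y. p l (y - x) < r} | l x r. 0 < r}" for x
    by (intro CollectI exI[of _ 0] exI[of _ x] exI[of _ "1::real"] conjI refl) simp
  then have "x \<in> topspace (seminorm_topology p)" for x
    unfolding seminorm_topology_def topology_generated_by_topspace using mem[of x] by (rule UnionI)
  then have "topspace (seminorm_topology p) = UNIV" by blast
  then show ?thesis by (simp add: lc_closed_def alg_bimod_def)
qed

end

theory Submission
  imports Defs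
begin

text \<open>
  A Montel Frechet algebra is reflexive: evaluation \<open>A \<rightarrow> A\<^sup>*\<^sup>*\<close> is continuous because \<open>A\<close> is
  barrelled, injective and open by the Hahn-Banach theorem, and surjective because bounded sets lie
  in compact convex balanced ones. It is also a bimodule map, and dualizing it repeatedly shows that
  the topological bimodules \<open>A\<^sup>(\<^sup>n\<^sup>+\<^sup>2\<^sup>)\<close> and \<open>A\<^sup>(\<^sup>n\<^sup>)\<close> are isomorphic.
\<close>

section \<open>Topological bimodules\<close>

text \<open>A derivation is pushed forward along the isomorphism and the element implementing it is
  pulled back, so both directions are used. Duals of different order live in different types and are
  seen only through coded copies; hence isomorphisms relate bimodules over arbitrary carrier types,
  and every coding step is itself one. The hard point is surjectivity of evaluation. Strong
  continuity bounds a functional \<Phi> on the dual by suprema over a bounded set. A Goldstine type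
  argument only yields points that agree with \<Phi> on finitely many functionals. The Montel
  property makes the set compact in the original topology, where each condition
  \<open>f x = \<Phi> f\<close> is closed, so all of them have a common solution. Compactness also
  provides the finite agreement, by least squares minimization, without weak topologies or bipolars.
  Hahn-Banach enters only as the existence of a functional dominated by a seminorm and attaining it
  at a given point. This comes from minimal sublinear functionals, without extending anything from a
  subspace.\<close>

definition lc_hom :: "('v \<Rightarrow> 'w) \<Rightarrow> ('v, 'm) lcs_scheme \<Rightarrow> ('w, 'k) lcs_scheme \<Rightarrow> bool" where
  "lc_hom T X Y \<longleftrightarrow> continuous_map (topo X) (topo Y) T \<and> T (vzero X) = vzero Y \<and>
     (\<forall>x\<in>carr X. \<forall>y\<in>carr X. T (vadd X x y) = vadd Y (T x) (T y)) \<and>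
     (\<forall>c. \<forall>x\<in>carr X. T (vscale X c x) = vscale Y c (T x))"

lemma lc_hom_carr: "lc_hom T X Y \<Longrightarrow> x \<in> carr X \<Longrightarrow> T x \<in> carr Y"
  by (auto simp: lc_hom_def continuous_map_def)

lemma lc_hom_compose:
  assumes "lc_hom T X Y" "lc_hom S Y Z"
  shows "lc_hom (S \<circ> T) X Z"
  using assms lc_hom_carr[OF assms(1)] continuous_map_compose[of "topo X" "topo Y" T "topo Z" S]
  by (simp add: lc_hom_def)

lemma lc_hom_cong:
  assumes "lc_hom T X Y" "lc_closed X" "\<And>x. x \<in> carr X \<Longrightarrow> S x = T x"
  shows "lc_hom S X Y"
  using assms continuous_map_eq[of "topo X" "topo Y" T S] by (simp add: lc_hom_def lc_closed_def)

lemma lc_iso_hom: "lc_iso h X Y \<Longrightarrow> lc_hom h X Y"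
  by (simp add: lc_iso_def lc_hom_def homeomorphic_eq_everything_map)

text \<open>The preimage of a neighbourhood of zero is one as well, so it absorbs \<open>B\<close>;
  homogeneity carries the absorption through \<open>T\<close>.\<close>

lemma lc_hom_bounded_image:
  assumes T: "lc_hom T X Y" and X: "lc_closed X" and B: "lc_bounded X B"
  shows "lc_bounded Y (T ` B)"
  unfolding lc_bounded_def
proof (intro conjI allI impI)
  show "T ` B \<subseteq> carr Y" using B lc_hom_carr[OF T] by (auto simp: lc_bounded_def)
  fix U assume U: "openin (topo Y) U \<and> vzero Y \<in> U"
  let ?V = "{x \<in> carr X. T x \<in> U}"
  have "openin (topo X) ?V" "vzero X \<in> ?V"
    using T U X by (auto simp: lc_hom_def lc_closed_def continuous_map_def)
  then have "absorbs X ?V B" using B unfolding lc_bounded_def by blast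
  then obtain r where r: "0 < r" "\<And>c. r \<le> cmod c \<Longrightarrow> B \<subseteq> vscale X c ` ?V"
    unfolding absorbs_def by blast
  have "T ` B \<subseteq> vscale Y c ` U" if c: "r \<le> cmod c" for c
  proof
    fix y assume "y \<in> T ` B"
    then obtain v where "v \<in> ?V" "y = T (vscale X c v)" using r(2)[OF c] by blast
    then show "y \<in> vscale Y c ` U" using T by (auto simp: lc_hom_def)
  qed
  with r(1) show "absorbs Y U (T ` B)" unfolding absorbs_def by blast
qed

lemma dual_space_compose:
  assumes T: "lc_hom T X Y" and X: "lc_closed X" and f: "f \<in> dual_space Y"
  shows "(\<lambda>x\<in>carr X. f (T x)) \<in> dual_space X"
proof -
  have "continuous_map (topo X) euclidean (f \<circ> T)"
    using T f continuous_map_compose by (auto simp: dual_space_def lc_hom_def)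
  then have "continuous_map (topo X) euclidean (\<lambda>x\<in>carr X. f (T x))"
    by (rule continuous_map_eq) auto
  then show ?thesis using T X f lc_hom_carr[OF T] by (simp add: dual_space_def lc_closed_def lc_hom_def)
qed

lemma lc_hom_strong_dual:
  fixes X :: "('a, 'v) lcbimod" and Y :: "('a, 'w) lcbimod"
  assumes T: "lc_hom T X Y" and X: "lc_closed X"
  shows "lc_hom (\<lambda>f. \<lambda>x\<in>carr X. f (T x)) (strong_dual Y) (strong_dual X)"
proof -
  let ?H = "\<lambda>f. \<lambda>x\<in>carr X. f (T x)"
  have "strong_open Y {f \<in> dual_space Y. ?H f \<in> W}" if W: "strong_open X W" for W
    unfolding strong_open_def
  proof (intro conjI ballI)
    fix f assume f: "f \<in> {f \<in> dual_space Y. ?H f \<in> W}"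
    then obtain B e where B: "lc_bounded X B" "0 < e"
      "{g \<in> dual_space X. \<forall>x\<in>B. cmod (g x - ?H f x) < e} \<subseteq> W"
      using W unfolding strong_open_def by blast
    have s: "B \<subseteq> carr X" using B by (simp add: lc_bounded_def)
    have "{g \<in> dual_space Y. \<forall>x\<in>T ` B. cmod (g x - f x) < e} \<subseteq> {f \<in> dual_space Y. ?H f \<in> W}"
    proof safe
      fix g assume g: "g \<in> dual_space Y" "\<forall>x\<in>T ` B. cmod (g x - f x) < e"
      have "?H g \<in> {g \<in> dual_space X. \<forall>x\<in>B. cmod (g x - ?H f x) < e}"
        using dual_space_compose[OF T X g(1)] g(2) s by auto
      with B show "?H g \<in> W" by blast
    qed
    with lc_hom_bounded_image[OF T X B(1)] B(2)
    show "\<exists>B e. lc_bounded Y B \<and> 0 < e \<and>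
        {g \<in> dual_space Y. \<forall>x\<in>B. cmod (g x - f x) < e} \<subseteq> {f \<in> dual_space Y. ?H f \<in> W}"
      by blast
  qed auto
  then have "continuous_map (topo (strong_dual Y)) (topo (strong_dual X)) ?H"
    using dual_space_compose[OF T X]
    unfolding continuous_map_def topspace_strong_dual openin_strong_dual by blast
  then show ?thesis using lc_hom_carr[OF T]
    by (auto simp: lc_hom_def strong_dual_def Let_def intro!: ext)
qed

section \<open>Bimodules with separately continuous actions and their isomorphisms\<close>

definition lc_bimod :: "('a, 'v) lcbimod \<Rightarrow> bool" where
  "lc_bimod X \<longleftrightarrow> lc_closed X \<and> (\<forall>a. lc_hom (lact X a) X X) \<and> (\<forall>a. lc_hom (\<lambda>x. ract X x a) X X)"

lemma lc_bimod_carr: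
  "lc_bimod X \<Longrightarrow> x \<in> carr X \<Longrightarrow> lact X a x \<in> carr X"
  "lc_bimod X \<Longrightarrow> x \<in> carr X \<Longrightarrow> ract X x a \<in> carr X"
  unfolding lc_bimod_def using lc_hom_carr by metis+

text \<open>The actions on the dual are the transposes of the actions on the opposite side, so
  continuity of each single multiplication is what passes from a space to its dual.\<close>

lemma lc_bimod_strong_dual:
  assumes X: "lc_bimod X"
  shows "lc_bimod (strong_dual X)"
proof -
  have c: "lc_closed X" using X by (simp add: lc_bimod_def)
  have "lc_hom (\<lambda>f. \<lambda>x\<in>carr X. f (lact X a x)) (strong_dual X) (strong_dual X)"
    and "lc_hom (\<lambda>f. \<lambda>x\<in>carr X. f (ract X x a)) (strong_dual X) (strong_dual X)" for a
    by (rule lc_hom_strong_dual[OF _ c], use X in \<open>simp add: lc_bimod_def\<close>)+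
  moreover have "lact (strong_dual X) = (\<lambda>a f. \<lambda>x\<in>carr X. f (ract X x a))"
    "ract (strong_dual X) = (\<lambda>f a. \<lambda>x\<in>carr X. f (lact X a x))"
    by (simp_all add: strong_dual_def Let_def)
  ultimately show ?thesis
    using lc_closed_strong_dual[OF c] by (simp add: lc_bimod_def)
qed

definition bimod_iso :: "('v \<Rightarrow> 'w) \<Rightarrow> ('a, 'v) lcbimod \<Rightarrow> ('a, 'w) lcbimod \<Rightarrow> bool" where
  "bimod_iso h X Y \<longleftrightarrow> lc_bimod X \<and> lc_iso h X Y \<and>
     (\<forall>a. \<forall>x\<in>carr X. h (lact X a x) = lact Y a (h x) \<and> h (ract X x a) = ract Y (h x) a)"

text \<open>On its carrier \<open>Y\<close> acts by the conjugates of the actions of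
  \<open>X\<close> under \<open>h\<close>, and these are compositions of continuous linear
  maps.\<close>

lemma bimod_iso_lc_bimod:
  assumes h: "bimod_iso h X Y"
  shows "lc_bimod Y"
proof -
  let ?g = "inv_into (carr X) h"
  have i: "lc_iso h X Y" and X: "lc_bimod X" using h by (simp_all add: bimod_iso_def)
  have hg: "h (?g y) = y" "?g y \<in> carr X" if "y \<in> carr Y" for y
    using lc_iso_img(1)[OF i] that by (auto simp: f_inv_into_f inv_into_into)
  note g = lc_iso_hom[OF lc_iso_inv[OF i]] and hom = lc_iso_hom[OF i]
  have "lc_hom (h \<circ> (lact X a \<circ> ?g)) Y Y" "lc_hom (h \<circ> ((\<lambda>x. ract X x a) \<circ> ?g)) Y Y" for a
    by (rule lc_hom_compose[OF lc_hom_compose[OF g] hom], use X in \<open>simp add: lc_bimod_def\<close>)+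
  note hom' = this
  have "lc_hom (lact Y a) Y Y" for a
    by (rule lc_hom_cong[OF hom'(1)[of a] lc_iso_closed[OF i]]) (use h hg in \<open>simp add: bimod_iso_def\<close>)
  moreover have "lc_hom (\<lambda>x. ract Y x a) Y Y" for a
    by (rule lc_hom_cong[OF hom'(2)[of a] lc_iso_closed[OF i]]) (use h hg in \<open>simp add: bimod_iso_def\<close>)
  ultimately show ?thesis using lc_iso_closed[OF i] by (simp add: lc_bimod_def)
qed

lemma bimod_iso_sym:
  assumes h: "bimod_iso h X Y"
  shows "bimod_iso (inv_into (carr X) h) Y X"
proof -
  let ?g = "inv_into (carr X) h"
  have i: "lc_iso h X Y" and X: "lc_bimod X" using h by (simp_all add: bimod_iso_def)
  have "?g (lact Y a y) = lact X a (?g y) \<and> ?g (ract Y y a) = ract X (?g y) a" if y: "y \<in> carr Y" for a y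
  proof -
    obtain x where x: "y = h x" "x \<in> carr X" using y lc_iso_img(1)[OF i] by blast
    have "lact Y a y = h (lact X a x)" "ract Y y a = h (ract X x a)"
      using h x by (simp_all add: bimod_iso_def)
    then show ?thesis using x lc_bimod_carr[OF X x(2)] lc_iso_img(2)[OF i] by simp
  qed
  then show ?thesis using bimod_iso_lc_bimod[OF h] lc_iso_inv[OF i] by (simp add: bimod_iso_def)
qed

lemma bimod_iso_trans:
  assumes h: "bimod_iso h X Y" and k: "bimod_iso k Y Z"
  shows "bimod_iso (k \<circ> h) X Z"
proof -
  have i: "lc_iso h X Y" "lc_iso k Y Z" using h k by (simp_all add: bimod_iso_def)
  have m: "h x \<in> carr Y" if "x \<in> carr X" for x using lc_iso_img(1)[OF i(1)] that by blast
  have "lc_iso (k \<circ> h) X Z"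
    using i m homeomorphic_map_compose[of "topo X" "topo Y" h "topo Z" k] by (simp add: lc_iso_def)
  then show ?thesis using h k m by (simp add: bimod_iso_def)
qed

lemma bimod_iso_copy_along:
  assumes X: "lc_bimod X" and h: "inj_on h (carr X)"
  shows "bimod_iso h X (copy_along h X)"
  unfolding bimod_iso_def
  using assms lc_iso_copy_along[OF _ h] by (simp add: lc_bimod_def copy_along_def Let_def)

lemma bimod_iso_strong_dual:
  assumes h: "bimod_iso h X Y"
  shows "bimod_iso (\<lambda>f. \<lambda>x\<in>carr X. f (h x)) (strong_dual Y) (strong_dual X)"
proof -
  have i: "lc_iso h X Y" and X: "lc_bimod X" using h by (simp_all add: bimod_iso_def)
  have "h x \<in> carr Y" if "x \<in> carr X" for x using lc_iso_img(1)[OF i] that by blast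
  then show ?thesis
    using lc_bimod_strong_dual[OF bimod_iso_lc_bimod[OF h]] lc_iso_strong_dual[OF i] h lc_bimod_carr[OF X]
    unfolding bimod_iso_def by (auto simp: strong_dual_def Let_def intro!: ext)
qed

definition bimod_isomorphic :: "('a, 'v) lcbimod \<Rightarrow> ('a, 'w) lcbimod \<Rightarrow> bool" where
  "bimod_isomorphic X Y \<longleftrightarrow> (\<exists>h. bimod_iso h X Y)"

lemma bimod_isomorphic_sym: "bimod_isomorphic X Y \<Longrightarrow> bimod_isomorphic Y X"
  unfolding bimod_isomorphic_def using bimod_iso_sym by blast

lemma bimod_isomorphic_trans [trans]:
  "bimod_isomorphic X Y \<Longrightarrow> bimod_isomorphic Y Z \<Longrightarrow> bimod_isomorphic X Z"
  unfolding bimod_isomorphic_def using bimod_iso_trans by blast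

text \<open>Transposition reverses the arrow; symmetry of the relation restores the direction, so
  that dualization can be iterated.\<close>

lemma bimod_isomorphic_strong_dual:
  "bimod_isomorphic X Y \<Longrightarrow> bimod_isomorphic (strong_dual X) (strong_dual Y)"
  using bimod_iso_strong_dual bimod_isomorphic_sym unfolding bimod_isomorphic_def by blast

lemma bimod_isomorphic_copy_along:
  "lc_bimod X \<Longrightarrow> inj_on h (carr X) \<Longrightarrow> bimod_isomorphic (copy_along h X) X"
  using bimod_iso_copy_along bimod_isomorphic_sym unfolding bimod_isomorphic_def by blast

section \<open>Coded iterated duals up to isomorphism\<close>

lemma lc_bimod_iter_dual:
  assumes A: "lc_bimod A" and d: "dual_coding j c A N"
  shows "k \<le> N \<Longrightarrow> lc_bimod (iter_dual j c A k)"
proof (induction k)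
  case 0
  show ?case using bimod_iso_lc_bimod[OF bimod_iso_copy_along[OF A, of j]] d
    by (simp add: dual_coding_def)
next
  case (Suc k)
  have "inj_on (c k) (carr (strong_dual (iter_dual j c A k)))"
    using d Suc.prems by (simp add: dual_coding_def topspace_strong_dual)
  then show ?case
    using bimod_iso_lc_bimod[OF bimod_iso_copy_along[OF lc_bimod_strong_dual]] Suc by simp
qed

lemma iter_dual_Suc_isomorphic:
  assumes A: "lc_bimod A" and d: "dual_coding j c A N" and k: "k < N"
  shows "bimod_isomorphic (iter_dual j c A (Suc k)) (strong_dual (iter_dual j c A k))"
  using bimod_isomorphic_copy_along[OF lc_bimod_strong_dual[OF lc_bimod_iter_dual[OF A d]], of k "c k"] d k
  by (simp add: dual_coding_def topspace_strong_dual)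

text \<open>Reflexivity settles degree zero once the copies made by \<open>j\<close>,
  \<open>c 0\<close> and \<open>c 1\<close> are peeled off; each further degree is the dual of the
  previous one. The bound \<open>k + 2 \<le> N\<close> guarantees that every coding map involved is
  injective.\<close>

lemma iter_dual_periodic:
  assumes A: "lc_bimod A" and d: "dual_coding j c A N"
    and refl: "bimod_isomorphic A (strong_dual (strong_dual A))"
  shows "k + 2 \<le> N \<Longrightarrow> bimod_isomorphic (iter_dual j c A k) (iter_dual j c A (k + 2))"
proof (induction k)
  case 0
  let ?A = "iter_dual j c A"
  have 0: "bimod_isomorphic (?A 0) A"
    using bimod_isomorphic_copy_along[OF A, of j] d by (simp add: dual_coding_def)
  also note refl
  also have "bimod_isomorphic (strong_dual (strong_dual A)) (strong_dual (strong_dual (?A 0)))"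
    by (rule bimod_isomorphic_strong_dual, rule bimod_isomorphic_strong_dual, rule bimod_isomorphic_sym, rule 0)
  also have "bimod_isomorphic \<dots> (strong_dual (?A (Suc 0)))"
    by (rule bimod_isomorphic_strong_dual, rule bimod_isomorphic_sym, rule iter_dual_Suc_isomorphic[OF A d])
      (use "0.prems" in simp)
  also have "bimod_isomorphic \<dots> (?A (Suc (Suc 0)))"
    by (rule bimod_isomorphic_sym, rule iter_dual_Suc_isomorphic[OF A d]) (use "0.prems" in simp)
  finally show ?case by simp
next
  case (Suc k)
  let ?A = "iter_dual j c A"
  have "bimod_isomorphic (?A (Suc k)) (strong_dual (?A k))"
    using iter_dual_Suc_isomorphic[OF A d] Suc.prems by simp
  also have "bimod_isomorphic \<dots> (strong_dual (?A (k + 2)))"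
    using Suc by (intro bimod_isomorphic_strong_dual) linarith
  also have "bimod_isomorphic \<dots> (?A (Suc (k + 2)))"
    by (rule bimod_isomorphic_sym, rule iter_dual_Suc_isomorphic[OF A d]) (use Suc.prems in simp)
  finally show ?case by simp
qed

text \<open>\<open>h \<circ> D\<close> is a derivation into \<open>Y\<close>, and the preimage of
  the element implementing it implements \<open>D\<close>. The condition on \<open>carr A\<close>
  places every value \<open>D a\<close> in \<open>carr X\<close>, where \<open>h\<close> is
  injective and respects the operations.\<close>

lemma inner_derivations_transfer:
  assumes iso: "bimod_isomorphic X Y"
    and Y: "\<And>D. continuous_derivation A Y D \<Longrightarrow> inner_derivation Y D"
    and top: "carr A = UNIV"
    and D: "continuous_derivation A X D"
  shows "inner_derivation X D"
proof -
  obtain h where h: "bimod_iso h X Y" using iso by (auto simp: bimod_isomorphic_def)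
  have i: "lc_iso h X Y" and X: "lc_bimod X" using h by (simp_all add: bimod_iso_def)
  have X': "lc_closed X" using X by (simp add: lc_bimod_def)
  note m = lc_bimod_carr[OF X]
  have Dc: "D a \<in> carr X" for a
    using D top by (auto simp: continuous_derivation_def continuous_map_def)
  have "continuous_map (topo A) (topo Y) (h \<circ> D)"
    using D lc_iso_hom[OF i] continuous_map_compose
    by (auto simp: continuous_derivation_def lc_hom_def)
  then have "continuous_derivation A Y (h \<circ> D)"
    using D Dc m h i by (simp add: continuous_derivation_def bimod_iso_def lc_iso_def)
  then obtain y where y: "y \<in> carr Y"
    "\<And>a. h (D a) = vadd Y (lact Y a y) (vscale Y (-1) (ract Y y a))"
    using Y[of "h \<circ> D"] by (auto simp: inner_derivation_def)
  obtain x where x: "x \<in> carr X" "y = h x" using y(1) lc_iso_img(1)[OF i] by blast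
  have "D a = vadd X (lact X a x) (vscale X (-1) (ract X x a))" for a
  proof (rule inj_onD[OF lc_iso_img(2)[OF i]])
    show "h (D a) = h (vadd X (lact X a x) (vscale X (-1) (ract X x a)))"
      using y(2)[of a] x m X' h i by (simp add: bimod_iso_def lc_iso_def lc_closed_def)
  qed (use Dc x m X' in \<open>auto simp: lc_closed_def\<close>)
  with x(1) show ?thesis by (auto simp: inner_derivation_def)
qed

section \<open>The Hahn-Banach theorem for seminorms\<close>

locale complex_vector_space = vector_space s for s :: "complex \<Rightarrow> 'a::ab_group_add \<Rightarrow> 'a"
begin

text \<open>Homogeneity is stated as an inequality, which is convenient to check for infima; scaling
  back by \<open>1 / t\<close> recovers equality in \<open>sublinear_scale\<close>.\<close>

definition sublinear :: "('a \<Rightarrow> real) \<Rightarrow> bool" where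
  "sublinear q \<longleftrightarrow> (\<forall>x y. q (x + y) \<le> q x + q y) \<and>
     (\<forall>t x. 0 \<le> t \<longrightarrow> q (s (complex_of_real t) x) \<le> t * q x)"

lemma sublinear_add: "sublinear q \<Longrightarrow> q (x + y) \<le> q x + q y"
  by (simp add: sublinear_def)

lemma sublinear_0: "sublinear q \<Longrightarrow> q 0 = 0"
proof -
  assume q: "sublinear q"
  have "q 0 \<le> q 0 + q 0" using sublinear_add[OF q, of 0 0] by simp
  moreover have "q (s (complex_of_real 0) 0) \<le> 0 * q 0" using q unfolding sublinear_def by blast
  ultimately show ?thesis by simp
qed

lemma sublinear_minus: "sublinear q \<Longrightarrow> - q (- x) \<le> q x"
  using sublinear_add[of q x "- x"] sublinear_0[of q] by simp

lemma sublinear_scale: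
  assumes q: "sublinear q" and t: "0 \<le> t"
  shows "q (s (complex_of_real t) x) = t * q x"
proof (cases "t = 0")
  case True then show ?thesis using sublinear_0[OF q] by simp
next
  case False
  have "q (s (complex_of_real (1 / t)) (s (complex_of_real t) x)) \<le> (1 / t) * q (s (complex_of_real t) x)"
    using q t unfolding sublinear_def by (metis zero_le_divide_1_iff)
  then have "t * q x \<le> q (s (complex_of_real t) x)" using False t by (simp add: field_simps)
  moreover have "q (s (complex_of_real t) x) \<le> t * q x" using q t by (simp add: sublinear_def)
  ultimately show ?thesis by simp
qed

text \<open>
  Applied to a minimal sublinear functional this forces \<open>q (- y) = - q y\<close>, so that minimal
  sublinear functionals are linear.
\<close>

lemma sublinear_descent:
  assumes q: "sublinear q"
  obtains r where "sublinear r" "\<And>z. r z \<le> q z" "r (- y) \<le> - q y"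
proof -
  \<comment> \<open>The choice \<open>t = 0\<close> gives \<open>r \<le> q\<close>, and
    \<open>t = 1\<close> at the point \<open>- y\<close> gives \<open>q 0 - q y\<close>.
    Subadditivity bounds the expression below by \<open>- q (- z)\<close> for every
    \<open>t\<close>, so the infimum is finite.\<close>
  let ?v = "\<lambda>z t. q (z + s (complex_of_real t) y) - t * q y"
  define r where "r z = (INF t\<in>{0..}. ?v z t)" for z
  have below: "- q (- z) \<le> ?v z t" if "0 \<le> t" for z t
    using sublinear_add[OF q, of "z + s (complex_of_real t) y" "- z"] sublinear_scale[OF q that, of y] by simp
  have le: "r z \<le> ?v z t" if "0 \<le> t" for z t
    unfolding r_def by (rule cINF_lower) (use below that in \<open>auto intro!: bdd_belowI2\<close>)
  have ge: "C \<le> r z" if "\<And>t. 0 \<le> t \<Longrightarrow> C \<le> ?v z t" for C z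
    unfolding r_def by (rule cINF_greatest) (use that in auto)
  have rq: "r z \<le> q z" for z using le[of 0 z] by simp
  show thesis
  proof
    show "sublinear r" unfolding sublinear_def
    proof (intro conjI allI impI)
      fix x z
      \<comment> \<open>The two parameters vary independently and are added on the left; taking the
        infimum over one and then the other gives subadditivity.\<close>
      have 1: "r (x + z) \<le> ?v x t + ?v z u" if "0 \<le> t" "0 \<le> u" for t u
        using le[of "t + u" "x + z"] that
          sublinear_add[OF q, of "x + s (complex_of_real t) y" "z + s (complex_of_real u) y"]
        by (simp add: algebra_simps)
      have "r (x + z) - ?v x t \<le> r z" if "0 \<le> t" for t
        by (rule ge) (use 1[OF that] in \<open>simp add: algebra_simps\<close>)
      then have "r (x + z) - r z \<le> r x" by (intro ge) (simp add: algebra_simps)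
      then show "r (x + z) \<le> r x + r z" by simp
    next
      fix t :: real and x assume t: "0 \<le> t"
      show "r (s (complex_of_real t) x) \<le> t * r x"
      proof (cases "t = 0")
        case True then show ?thesis using rq[of 0] sublinear_0[OF q] by simp
      next
        case False
        have "r (s (complex_of_real t) x) / t \<le> ?v x u" if "0 \<le> u" for u
        proof -
          have "?v (s (complex_of_real t) x) (t * u) = t * ?v x u"
            using sublinear_scale[OF q t, of "x + s (complex_of_real u) y"]
            by (simp add: algebra_simps)
          then show ?thesis using le[of "t * u" "s (complex_of_real t) x"] t that False
            by (simp add: field_simps)
        qed
        then have "r (s (complex_of_real t) x) / t \<le> r x" by (rule ge)
        then show ?thesis using t False by (simp add: field_simps)
      qed
    qed
    show "r z \<le> q z" for z by (rule rq)
    show "r (- y) \<le> - q y" using le[of 1 "- y"] sublinear_0[OF q] by simp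
  qed
qed

text \<open>Zorn's lemma applies because the pointwise infimum of a chain is again sublinear: of two
  members of the chain the smaller one serves for both summands. All members lie above
  \<open>- q (- x)\<close>, so the infimum is finite.\<close>

lemma sublinear_minimal:
  assumes q: "sublinear q"
  obtains u where "sublinear u" "\<And>x. u x \<le> q x"
    "\<And>r. sublinear r \<Longrightarrow> (\<And>x. r x \<le> u x) \<Longrightarrow> r = u"
proof -
  define A where "A = {u. sublinear u \<and> (\<forall>x. u x \<le> q x)}"
  \<comment> \<open>The order is reversed, so that the maximal elements found by Zorn's lemma are
    the minimal functionals.\<close>
  let ?P = "\<lambda>a b :: 'a \<Rightarrow> real. \<forall>x. b x \<le> a x"
  have po: "partial_order_on A (relation_of ?P A)"
    by (rule partial_order_on_relation_ofI) (auto intro: order_trans simp: fun_eq_iff antisym)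
  have bound: "\<exists>u\<in>A. \<forall>a\<in>C. ?P a u" if C: "C \<in> Chains (relation_of ?P A)" for C
  proof (cases "C = {}")
    case True then show ?thesis using q by (auto simp: A_def)
  next
    case False
    have sub: "C \<subseteq> A" and lin: "\<And>a b. a \<in> C \<Longrightarrow> b \<in> C \<Longrightarrow> ?P a b \<or> ?P b a"
      using C by (auto simp: Chains_def relation_of_def)
    define u where "u x = (INF r\<in>C. r x)" for x
    have below: "- q (- x) \<le> r x" if "r \<in> C" for r x
    proof -
      have "sublinear r" "r (- x) \<le> q (- x)" using sub that by (auto simp: A_def)
      then show ?thesis using sublinear_minus[of r x] by linarith
    qed
    have le: "u x \<le> r x" if "r \<in> C" for r x
      unfolding u_def by (rule cINF_lower) (use below that in \<open>auto intro!: bdd_belowI2\<close>)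
    have ge: "K \<le> u x" if "\<And>r. r \<in> C \<Longrightarrow> K \<le> r x" for K x
      unfolding u_def by (rule cINF_greatest) (use that False in auto)
    have sl: "sublinear r" if "r \<in> C" for r using sub that by (auto simp: A_def)
    have "sublinear u" unfolding sublinear_def
    proof (intro conjI allI impI)
      fix x y
      have 1: "u (x + y) \<le> a x + b y" if ab: "a \<in> C" "b \<in> C" for a b
        using lin[OF ab]
      proof
        assume "?P a b"
        then have "b x \<le> a x" by blast
        then show ?thesis using le[OF ab(2), of "x + y"] sublinear_add[OF sl[OF ab(2)], of x y] by linarith
      next
        assume "?P b a"
        then have "a y \<le> b y" by blast
        then show ?thesis using le[OF ab(1), of "x + y"] sublinear_add[OF sl[OF ab(1)], of x y] by linarith
      qed
      have "u (x + y) - a x \<le> u y" if "a \<in> C" for a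
        by (rule ge) (use 1[OF that] in \<open>simp add: algebra_simps\<close>)
      then have "u (x + y) - u y \<le> u x" by (intro ge) (simp add: algebra_simps)
      then show "u (x + y) \<le> u x + u y" by simp
    next
      fix t :: real and x assume t: "0 \<le> t"
      have *: "u (s (complex_of_real t) x) \<le> t * r x" if "r \<in> C" for r
        using le[OF that, of "s (complex_of_real t) x"] sublinear_scale[OF sl[OF that] t, of x] by simp
      show "u (s (complex_of_real t) x) \<le> t * u x"
      proof (cases "t = 0")
        case True then show ?thesis using * False by auto
      next
        case False
        then have "u (s (complex_of_real t) x) / t \<le> u x"
          by (intro ge) (use * t in \<open>simp add: field_simps\<close>)
        then show ?thesis using t False by (simp add: field_simps)
      qed
    qed
    moreover have "u x \<le> q x" for x
    proof -
      obtain r where "r \<in> C" using False by blast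
      moreover have "r x \<le> q x" using sub calculation by (auto simp: A_def)
      ultimately show ?thesis using le[of r x] by simp
    qed
    ultimately show ?thesis using le by (auto simp: A_def)
  qed
  obtain m where "m \<in> A" "\<forall>a\<in>A. ?P m a \<longrightarrow> a = m"
    using predicate_Zorn[OF po bound] by blast
  then show thesis by (intro that[of m]) (auto simp: A_def intro: order_trans)
qed

text \<open>Descending at \<open>y\<close> before passing to a minimal functional forces its value
  at \<open>y\<close> to be at least \<open>q y\<close>. Minimality makes it odd, hence real linear,
  and it becomes the real part of \<open>f\<close>.\<close>

lemma hahn_banach_seminorm:
  assumes tri: "\<And>x y. q (x + y) \<le> q x + q y" and hom: "\<And>c x. q (s c x) = cmod c * q x"
  obtains f :: "'a \<Rightarrow> complex" where "\<And>x y. f (x + y) = f x + f y" "\<And>c x. f (s c x) = c * f x"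
    "\<And>x. cmod (f x) \<le> q x" "f y = complex_of_real (q y)"
proof -
  have "sublinear q" by (simp add: sublinear_def tri hom)
  then obtain r where r: "sublinear r" "\<And>z. r z \<le> q z" "r (- y) \<le> - q y"
    using sublinear_descent by blast
  obtain u where u: "sublinear u" "\<And>x. u x \<le> r x"
    "\<And>r. sublinear r \<Longrightarrow> (\<And>x. r x \<le> u x) \<Longrightarrow> r = u"
    using sublinear_minimal[OF r(1)] by blast
  have odd: "u (- x) = - u x" for x
  proof -
    obtain v where v: "sublinear v" "\<And>z. v z \<le> u z" "v (- x) \<le> - u x"
      using sublinear_descent[OF u(1)] by blast
    have "v = u" by (rule u(3)) (use v in auto)
    then show ?thesis using v(3) sublinear_minus[OF u(1), of x] by simp
  qed
  have add: "u (x + z) = u x + u z" for x z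
    using sublinear_add[OF u(1), of x z] sublinear_add[OF u(1), of "- x" "- z"] odd[of x] odd[of z] odd[of "x + z"]
    by simp
  have sc: "u (s (complex_of_real t) x) = t * u x" for t x
  proof (cases "0 \<le> t")
    case True then show ?thesis using sublinear_scale[OF u(1)] by simp
  next
    case False
    then have "u (s (complex_of_real (- t)) x) = - t * u x" by (intro sublinear_scale[OF u(1)]) simp
    then show ?thesis using odd[of "s (complex_of_real t) x"] by simp
  qed
  define f where "f x = Complex (u x) (- u (s \<i> x))" for x
  have f_add: "f (x + z) = f x + f z" for x z
    by (simp add: f_def add scale_right_distrib complex_eq_iff)
  have f_scale: "f (s c x) = c * f x" for c x
  proof -
    have c: "s c x = s (complex_of_real (Re c)) x + s (complex_of_real (Im c)) (s \<i> x)"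
      by (simp add: scale_left_distrib[symmetric] complex_eq_iff)
    have ic: "s \<i> (s c x) = s (complex_of_real (Re c)) (s \<i> x) + s (complex_of_real (- Im c)) x"
      by (simp only: scale_scale scale_left_distrib[symmetric]) (rule arg_cong[of _ _ "\<lambda>c. s c x"], simp add: complex_eq_iff)
    have "u (s c x) = Re c * u x + Im c * u (s \<i> x)"
      "u (s \<i> (s c x)) = Re c * u (s \<i> x) - Im c * u x"
      unfolding ic unfolding c add sc by simp_all
    then show ?thesis by (simp add: f_def complex_eq_iff)
  qed
  have bound: "cmod (f x) \<le> q x" for x
  proof (cases "f x = 0")
    case True
    have "0 \<le> q x" using tri[of x "s (-1) x"] hom[of "-1" x] hom[of 0 0] by simp
    then show ?thesis using True by simp
  next
    case False
    \<comment> \<open>Multiplication by \<open>w\<close> rotates \<open>f x\<close> onto the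
      positive real axis, so the bound on real parts becomes a bound on the modulus.\<close>
    define w where "w = cnj (f x) / cmod (f x)"
    have w: "cmod w = 1" using False by (simp add: w_def norm_divide)
    have "w * f x = cmod (f x)" using False
      by (simp add: w_def complex_norm_square[symmetric] mult.commute power2_eq_square)
    then have "cmod (f x) = u (s w x)"
      using f_scale[of w x] by (metis Re_complex_of_real complex.sel(1) f_def)
    also have "\<dots> \<le> q (s w x)" using u(2)[of "s w x"] r(2)[of "s w x"] by linarith
    finally show ?thesis using hom w by simp
  qed
  have "q y \<le> Re (f y)" using u(2)[of "- y"] r(3) odd[of y] by (simp add: f_def)
  then have "Re (f y) = q y" "cmod (f y) = q y"
    using bound[of y] complex_Re_le_cmod[of "f y"] by linarith+
  then have "f y = complex_of_real (q y)"
    using cmod_power2[of "f y"] by (simp add: complex_eq_iff)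
  then show thesis using that f_add f_scale bound by blast
qed

end

section \<open>Reflexivity of Montel Frechet algebras\<close>

locale frechet_alg =
  fixes s :: "complex \<Rightarrow> 'a::ring \<Rightarrow> 'a" and p :: "nat \<Rightarrow> 'a \<Rightarrow> real"
  assumes frechet: "frechet_algebra s p"

sublocale frechet_alg \<subseteq> complex_vector_space s
  using frechet unfolding frechet_algebra_def complex_vector_space_def by (elim conjE)

context frechet_alg
begin

abbreviation X :: "('a, 'a) lcbimod" where "X \<equiv> alg_bimod s p"

section \<open>Topology and bounded sets of the algebra\<close>

lemma p_add: "p l (x + y) \<le> p l x + p l y"
  and p_scale: "p l (s c x) = cmod c * p l x"
  and p_mult: "p l (x * y) \<le> p l x * p l y"
  and p_Suc: "p l x \<le> p (Suc l) x"
  and p_separates: "(\<And>l. p l x = 0) \<Longrightarrow> x = 0"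
  and mult_scale: "s c x * y = s c (x * y)" "x * s c y = s c (x * y)"
  using frechet unfolding frechet_algebra_def by metis+

lemma p_mono: "l \<le> m \<Longrightarrow> p l x \<le> p m x"
  by (rule lift_Suc_mono_le[of "\<lambda>l. p l x"]) (rule p_Suc)

lemma p_zero [simp]: "p l 0 = 0"
  using p_scale[of l 0 0] by simp

lemma p_minus: "p l (- x) = p l x"
  using p_scale[of l "- 1" x] by simp

lemma p_nonneg: "0 \<le> p l x"
  using p_add[of l x "- x"] p_minus[of l x] by simp

lemma p_diff_commute: "p l (x - y) = p l (y - x)"
  using p_minus[of l "x - y"] by simp

lemma p_triangle: "p l x \<le> p l y + p l (x - y)"
  using p_add[of l y "x - y"] by simp

text \<open>The balls are only a subbase. Since the seminorms increase, a finite intersection of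
  balls with one centre contains a single ball with that centre; the triangle inequality handles
  other centres.\<close>

lemma openin_seminorm_topology:
  "openin (seminorm_topology p) U \<longleftrightarrow> (\<forall>x\<in>U. \<exists>l r. 0 < r \<and> (\<forall>y. p l (y - x) < r \<longrightarrow> y \<in> U))"
proof
  assume "openin (seminorm_topology p) U"
  then have "generate_topology_on {{y. p l (y - x) < r} | l x r. 0 < r} U"
    by (simp add: seminorm_topology_def openin_topology_generated_by_iff)
  then show "\<forall>x\<in>U. \<exists>l r. 0 < r \<and> (\<forall>y. p l (y - x) < r \<longrightarrow> y \<in> U)"
  proof induction
    case (Int a b)
    show ?case
    proof
      fix x assume x: "x \<in> a \<inter> b"
      obtain l r where l: "0 < r" "\<And>y. p l (y - x) < r \<Longrightarrow> y \<in> a" using Int.IH(1) x by blast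
      obtain m q where m: "0 < q" "\<And>y. p m (y - x) < q \<Longrightarrow> y \<in> b" using Int.IH(2) x by blast
      have "y \<in> a \<inter> b" if "p (max l m) (y - x) < min r q" for y
        using l(2)[of y] m(2)[of y] that p_mono[of l "max l m" "y - x"] p_mono[of m "max l m" "y - x"] by simp
      then show "\<exists>l r. 0 < r \<and> (\<forall>y. p l (y - x) < r \<longrightarrow> y \<in> a \<inter> b)"
        using l(1) m(1) by (intro exI[of _ "max l m"] exI[of _ "min r q"]) simp
    qed
  next
    case (UN K)
    then show ?case by (meson UnionE UnionI)
  next
    case (Basis U)
    then obtain l z r where U: "U = {y. p l (y - z) < r}" by blast
    have "y \<in> U" if "x \<in> U" "p l (y - x) < r - p l (x - z)" for x y
      using that p_add[of l "y - x" "x - z"] by (simp add: U)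
    moreover have "0 < r - p l (x - z)" if "x \<in> U" for x using that by (simp add: U)
    ultimately show ?case by blast
  qed simp
next
  assume U: "\<forall>x\<in>U. \<exists>l r. 0 < r \<and> (\<forall>y. p l (y - x) < r \<longrightarrow> y \<in> U)"
  show "openin (seminorm_topology p) U"
  proof (subst openin_subopen, rule ballI)
    fix x assume x: "x \<in> U"
    then obtain l r where r: "0 < r" "\<And>y. p l (y - x) < r \<Longrightarrow> y \<in> U" using U by blast
    have "openin (seminorm_topology p) {y. p l (y - x) < r}"
      unfolding seminorm_topology_def by (rule topology_generated_by_Basis) (use r in blast)
    with r show "\<exists>T. openin (seminorm_topology p) T \<and> x \<in> T \<and> T \<subseteq> U"
      by (intro exI[of _ "{y. p l (y - x) < r}"]) auto
  qed
qed

lemma openin_alg: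
  "openin (topo X) U \<longleftrightarrow> (\<forall>x\<in>U. \<exists>l r. 0 < r \<and> (\<forall>y. p l (y - x) < r \<longrightarrow> y \<in> U))"
  by (simp add: alg_bimod_def openin_seminorm_topology)

lemma carr_alg [simp]: "carr X = UNIV"
proof -
  have "openin (topo X) UNIV" unfolding openin_alg by (auto intro: exI[of _ "1::real"])
  then show ?thesis using openin_subset by blast
qed

lemma alg_simps [simp]: "vadd X = (+)" "vzero X = 0" "vscale X = s" "lact X = (*)" "ract X = (*)"
  by (simp_all add: alg_bimod_def)

lemma continuous_map_algI:
  assumes "\<And>x. T x \<in> topspace Y"
    and "\<And>V x. openin Y V \<Longrightarrow> T x \<in> V \<Longrightarrow> \<exists>l r. 0 < r \<and> (\<forall>y. p l (y - x) < r \<longrightarrow> T y \<in> V)"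
  shows "continuous_map (topo X) Y T"
  unfolding continuous_map_def using assms by (simp add: openin_alg)

lemma lc_bimod_alg: "lc_bimod X"
proof -
  have cont: "continuous_map (topo X) (topo X) T"
    if T: "\<And>x y. T (x - y) = T x - T y" "\<And>l x. p l (T x) \<le> K l * p l x" and K: "\<And>l. 0 \<le> K l"
    for T :: "'a \<Rightarrow> 'a" and K
  proof (rule continuous_map_algI)
    fix V x assume "openin (topo X) V" "T x \<in> V"
    then obtain l r where r: "0 < r" "\<And>y. p l (y - T x) < r \<Longrightarrow> y \<in> V"
      unfolding openin_alg by blast
    \<comment> \<open>The summand 1 keeps the radius meaningful when \<open>K l\<close> is
      zero.\<close>
    have "T y \<in> V" if "p l (y - x) < r / (K l + 1)" for y
    proof (rule r(2))
      have "p l (T y - T x) \<le> K l * p l (y - x)" using T(2)[of l "y - x"] by (simp add: T(1))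
      also have "\<dots> \<le> (K l + 1) * p l (y - x)" using p_nonneg by (simp add: algebra_simps)
      also have "\<dots> < r" using that K[of l] by (simp add: field_simps)
      finally show "p l (T y - T x) < r" .
    qed
    then show "\<exists>l r. 0 < r \<and> (\<forall>y. p l (y - x) < r \<longrightarrow> T y \<in> V)"
      using r(1) K[of l] by (intro exI[of _ l] exI[of _ "r / (K l + 1)"]) simp
  qed simp
  have "lc_hom ((*) a) X X" "lc_hom (\<lambda>x. x * a) X X" for a
    unfolding lc_hom_def
    by (auto simp: algebra_simps mult_scale intro!: cont[of _ "\<lambda>l. p l a"] p_mult p_nonneg
        intro: order_trans[OF p_mult])
  then show ?thesis using lc_closed_alg_bimod[OF frechet] by (simp add: lc_bimod_def)
qed

lemma lc_bounded_alg: "lc_bounded X B \<longleftrightarrow> (\<forall>l. \<exists>M. \<forall>x\<in>B. p l x \<le> M)"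
proof
  assume B: "lc_bounded X B"
  show "\<forall>l. \<exists>M. \<forall>x\<in>B. p l x \<le> M"
  proof
    fix l
    let ?U = "{x. p l x < 1}"
    have "openin (topo X) ?U" unfolding openin_alg
    proof
      fix x assume "x \<in> ?U"
      then show "\<exists>l r. 0 < r \<and> (\<forall>y. p l (y - x) < r \<longrightarrow> y \<in> ?U)"
        using p_triangle[of l _ x] by (intro exI[of _ l] exI[of _ "1 - p l x"]) (auto simp: algebra_simps intro: order.strict_trans1)
    qed
    then have "absorbs X ?U B" using B by (simp add: lc_bounded_def)
    then obtain r where r: "0 < r" "\<And>c. r \<le> cmod c \<Longrightarrow> B \<subseteq> s c ` ?U"
      by (auto simp: absorbs_def)
    have "p l x \<le> r" if x: "x \<in> B" for x
    proof -
      obtain u where "p l u < 1" "x = s (complex_of_real r) u" using subsetD[OF r(2)[of "complex_of_real r"] x] r(1) by auto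
      then show ?thesis using r(1) by (simp add: p_scale)
    qed
    then show "\<exists>M. \<forall>x\<in>B. p l x \<le> M" by blast
  qed
next
  assume B: "\<forall>l. \<exists>M. \<forall>x\<in>B. p l x \<le> M"
  show "lc_bounded X B" unfolding lc_bounded_def
  proof (intro conjI allI impI)
    fix U assume "openin (topo X) U \<and> vzero X \<in> U"
    then obtain l r where r: "0 < r" "\<And>y. p l y < r \<Longrightarrow> y \<in> U" unfolding openin_alg by fastforce
    obtain M where M: "\<And>x. x \<in> B \<Longrightarrow> p l x \<le> M" using B by blast
    \<comment> \<open>\<open>\<bar>M\<bar> + 1\<close> makes the threshold positive and the later
      estimate strict, whatever the sign of \<open>M\<close>.\<close>
    have R: "0 < (\<bar>M\<bar> + 1) / r" using r(1) by simp
    have "B \<subseteq> s c ` U" if c: "(\<bar>M\<bar> + 1) / r \<le> cmod c" for c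
    proof
      fix x assume x: "x \<in> B"
      have c0: "0 < cmod c" using c R by linarith
      have "p l x < r * cmod c" using c r(1) M[OF x] by (simp add: field_simps)
      then have "s (1 / c) x \<in> U" using c0 by (intro r(2)) (simp add: p_scale norm_divide field_simps)
      moreover have "x = s c (s (1 / c) x)" using c0 by simp
      ultimately show "x \<in> s c ` U" by blast
    qed
    with R show "absorbs X U B" unfolding absorbs_def by auto
  qed simp
qed

section \<open>Functionals on the algebra and on its strong dual\<close>

lemma dual_space_alg:
  "f \<in> dual_space X \<longleftrightarrow> (\<forall>x y. f (x + y) = f x + f y) \<and> (\<forall>c x. f (s c x) = c * f x) \<and>
     continuous_map (topo X) euclidean f"
  by (simp add: dual_space_def)

lemma dual_add: "f \<in> dual_space X \<Longrightarrow> f (x + y) = f x + f y"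
  and dual_scale: "f \<in> dual_space X \<Longrightarrow> f (s c x) = c * f x"
  and dual_continuous: "f \<in> dual_space X \<Longrightarrow> continuous_map (topo X) euclidean f"
  by (simp_all add: dual_space_alg)

lemma dual_diff: "f \<in> dual_space X \<Longrightarrow> f (x - y) = f x - f y"
  using dual_add[of f "x - y" y] by simp

lemma dual_zero: "f \<in> dual_space X \<Longrightarrow> f 0 = 0"
  using dual_diff[of f 0 0] by simp

lemma dual_space_algI:
  assumes add: "\<And>x y. f (x + y) = f x + f y" and scale: "\<And>c x. f (s c x) = c * f x"
    and le: "\<And>x. cmod (f x) \<le> p l x"
  shows "f \<in> dual_space X"
  unfolding dual_space_alg
proof (intro conjI allI)
  show "continuous_map (topo X) euclidean f"
  proof (rule continuous_map_algI)
    fix V x assume "openin euclidean V" "f x \<in> V"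
    then obtain e where e: "0 < e" "\<And>w. dist w (f x) < e \<Longrightarrow> w \<in> V" by (auto simp: open_dist)
    have "f y \<in> V" if "p l (y - x) < e" for y
    proof (rule e(2))
      have "f y - f x = f (y - x)" using add[of "y - x" x] by simp
      then show "dist (f y) (f x) < e" using le[of "y - x"] that by (simp add: dist_norm)
    qed
    with e(1) show "\<exists>l r. 0 < r \<and> (\<forall>y. p l (y - x) < r \<longrightarrow> f y \<in> V)" by blast
  qed simp
qed (fact add, fact scale)

lemma norming_functional:
  obtains f where "f \<in> dual_space X" "\<And>y. cmod (f y) \<le> p l y" "f x = complex_of_real (p l x)"
  using hahn_banach_seminorm[of "p l" x, OF p_add p_scale] dual_space_algI by metis

abbreviation dual :: "('a, 'a \<Rightarrow> complex) lcbimod" where "dual \<equiv> strong_dual X"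

lemma strong_dual_alg_simps [simp]:
  "vadd dual = (\<lambda>f g x. f x + g x)" "vzero dual = (\<lambda>x. 0)" "vscale dual = (\<lambda>c f x. c * f x)"
  "lact dual = (\<lambda>a f x. f (x * a))" "ract dual = (\<lambda>f a x. f (a * x))"
  by (simp_all add: strong_dual_def Let_def restrict_UNIV)

lemma lc_closed_dual: "lc_closed dual"
  using lc_closed_strong_dual[OF lc_closed_alg_bimod[OF frechet]] .

lemma dual_space_scale: "f \<in> dual_space X \<Longrightarrow> (\<lambda>x. c * f x) \<in> dual_space X"
  and dual_space_zero: "(\<lambda>x. 0) \<in> dual_space X"
  using lc_closed_dual by (simp_all add: lc_closed_def topspace_strong_dual)

lemma dual_sum_closed:
  "(\<And>f. f \<in> F \<Longrightarrow> f \<in> dual_space X) \<Longrightarrow> (\<lambda>x. \<Sum>f\<in>F. v f * f x) \<in> dual_space X"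
proof (induction F rule: infinite_finite_induct)
  case (insert f F)
  then have "(\<lambda>x. v f * f x) \<in> dual_space X" "(\<lambda>x. \<Sum>f\<in>F. v f * f x) \<in> dual_space X"
    using lc_closed_dual by (auto simp: lc_closed_def topspace_strong_dual)
  then have "(\<lambda>x. v f * f x + (\<Sum>f\<in>F. v f * f x)) \<in> dual_space X"
    using lc_closed_dual by (simp add: lc_closed_def topspace_strong_dual)
  then show ?case using insert.hyps by simp
qed (use lc_closed_dual in \<open>auto simp: lc_closed_def topspace_strong_dual\<close>)

lemma bidual_add: "\<Phi> \<in> dual_space dual \<Longrightarrow> f \<in> dual_space X \<Longrightarrow> g \<in> dual_space X \<Longrightarrow>
    \<Phi> (\<lambda>x. f x + g x) = \<Phi> f + \<Phi> g"
  and bidual_scale: "\<Phi> \<in> dual_space dual \<Longrightarrow> f \<in> dual_space X \<Longrightarrow> \<Phi> (\<lambda>x. c * f x) = c * \<Phi> f"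
  and bidual_extensional: "\<Phi> \<in> dual_space dual \<Longrightarrow> \<Phi> \<in> extensional (dual_space X)"
  by (simp_all add: dual_space_def[of dual] topspace_strong_dual)

lemma bidual_preimage:
  "\<Phi> \<in> dual_space dual \<Longrightarrow> open V \<Longrightarrow> openin (topo dual) {f \<in> dual_space X. \<Phi> f \<in> V}"
  by (simp add: dual_space_def[of dual] continuous_map_def topspace_strong_dual)

lemma bidual_sum:
  assumes \<Phi>: "\<Phi> \<in> dual_space dual"
  shows "(\<And>f. f \<in> F \<Longrightarrow> f \<in> dual_space X) \<Longrightarrow> \<Phi> (\<lambda>x. \<Sum>f\<in>F. v f * f x) = (\<Sum>f\<in>F. v f * \<Phi> f)"
proof (induction F rule: infinite_finite_induct)
  case (insert f F)
  have f: "f \<in> dual_space X" using insert by simp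
  then have "(\<lambda>x. v f * f x) \<in> dual_space X"
    using lc_closed_dual by (auto simp: lc_closed_def topspace_strong_dual)
  moreover have "(\<lambda>x. \<Sum>f\<in>F. v f * f x) \<in> dual_space X" by (rule dual_sum_closed) (use insert in simp)
  ultimately have "\<Phi> (\<lambda>x. v f * f x + (\<Sum>f\<in>F. v f * f x)) = v f * \<Phi> f + (\<Sum>f\<in>F. v f * \<Phi> f)"
    using bidual_add[OF \<Phi>] bidual_scale[OF \<Phi> f] insert by simp
  then show ?case using insert.hyps by simp
qed (use bidual_scale[OF \<Phi> dual_space_zero, of 0] in simp_all)

section \<open>The evaluation map into the bidual\<close>

definition evaluation :: "'a \<Rightarrow> ('a \<Rightarrow> complex) \<Rightarrow> complex" where
  "evaluation x = (\<lambda>f\<in>dual_space X. f x)"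

text \<open>Singletons are bounded, so convergence in the strong dual implies convergence at
  \<open>x\<close>. The restriction in \<open>evaluation\<close> matches the extensionality required
  of members of \<open>dual_space\<close>.\<close>

lemma evaluation_bidual: "evaluation x \<in> dual_space dual"
proof -
  have "strong_open X {f \<in> dual_space X. f x \<in> V}" if V: "open V" for V
    unfolding strong_open_def
  proof (intro conjI ballI)
    fix f assume "f \<in> {f \<in> dual_space X. f x \<in> V}"
    then obtain e where e: "0 < e" "\<And>w. dist w (f x) < e \<Longrightarrow> w \<in> V" using V by (auto simp: open_dist)
    have "lc_bounded X {x}" by (auto simp: lc_bounded_alg)
    moreover have "{g \<in> dual_space X. \<forall>y\<in>{x}. cmod (g y - f y) < e} \<subseteq> {f \<in> dual_space X. f x \<in> V}"
      using e(2) by (auto simp: dist_norm)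
    ultimately show "\<exists>B e. lc_bounded X B \<and> 0 < e \<and>
        {g \<in> dual_space X. \<forall>x\<in>B. cmod (g x - f x) < e} \<subseteq> {f \<in> dual_space X. f x \<in> V}"
      using e(1) by blast
  qed auto
  then have "continuous_map (topo dual) euclidean (\<lambda>f. f x)"
    by (simp add: continuous_map_def topspace_strong_dual openin_strong_dual)
  then have "continuous_map (topo dual) euclidean (evaluation x)"
    by (rule continuous_map_eq) (simp add: evaluation_def topspace_strong_dual)
  then show ?thesis
    using lc_closed_dual
    by (simp add: dual_space_def[of dual] lc_closed_def topspace_strong_dual evaluation_def)
qed

lemma evaluation_inj: "inj evaluation"
proof (rule injI)
  fix x y assume eq: "evaluation x = evaluation y"
  have "p l (x - y) = 0" for l
  proof -
    obtain f where f: "f \<in> dual_space X" "f (x - y) = complex_of_real (p l (x - y))"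
      using norming_functional by metis
    have "f x = f y" using fun_cong[OF eq, of f] f(1) by (simp add: evaluation_def)
    then show ?thesis using f by (simp add: dual_diff)
  qed
  then show "x = y" using p_separates[of "x - y"] by simp
qed

text \<open>This is a multiple of the prepolar of \<open>H\<close>. It absorbs each point
  \<open>x\<close> because \<open>H\<close> is absorbed by the strong neighbourhood of functionals
  smaller than \<open>e\<close> at \<open>x\<close>.\<close>

lemma polar_barrel:
  assumes H: "lc_bounded dual H" and e: "0 < e"
  shows "barrel X {x. \<forall>f\<in>H. cmod (f x) \<le> e}" (is "barrel X ?T")
proof -
  have HX: "f \<in> dual_space X" if "f \<in> H" for f
    using H that by (auto simp: lc_bounded_def topspace_strong_dual)
  have "closedin (topo X) {x. cmod (f x) \<le> e}" if "f \<in> H" for f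
    using closedin_continuous_map_preimage[OF dual_continuous[OF HX[OF that]], of "cball 0 e"] by simp
  then have "closedin (topo X) (topspace (topo X) \<inter> (\<Inter>f\<in>H. {x. cmod (f x) \<le> e}))"
    using closedin_topspace[of "topo X"] by (cases "H = {}") (auto intro!: closedin_INT)
  moreover have "topspace (topo X) \<inter> (\<Inter>f\<in>H. {x. cmod (f x) \<le> e}) = ?T" by auto
  ultimately have closed: "closedin (topo X) ?T" by simp
  have convex: "s (complex_of_real t) x + s (complex_of_real (1 - t)) y \<in> ?T"
    if "x \<in> ?T" "y \<in> ?T" "0 \<le> t" "t \<le> 1" for x y t
  proof clarify
    fix f assume f: "f \<in> H"
    have "cmod (f (s (complex_of_real t) x + s (complex_of_real (1 - t)) y)) \<le> t * cmod (f x) + (1 - t) * cmod (f y)"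
      using norm_triangle_ineq[of "complex_of_real t * f x" "complex_of_real (1 - t) * f y"] that(3,4)
      by (simp add: dual_add[OF HX[OF f]] dual_scale[OF HX[OF f]] norm_mult del: of_real_diff)
    also have "\<dots> \<le> t * e + (1 - t) * e"
      using that f by (intro add_mono mult_left_mono) auto
    finally show "cmod (f (s (complex_of_real t) x + s (complex_of_real (1 - t)) y)) \<le> e"
      by (simp add: algebra_simps)
  qed
  have balanced: "s c x \<in> ?T" if "x \<in> ?T" "cmod c \<le> 1" for x c
  proof clarify
    fix f assume f: "f \<in> H"
    have "cmod c * cmod (f x) \<le> 1 * e" using that f by (intro mult_mono) auto
    then show "cmod (f (s c x)) \<le> e" by (simp add: dual_scale[OF HX[OF f]] norm_mult)
  qed
  have absorbing: "absorbs X ?T {x}" for x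
  proof -
    let ?V = "{f \<in> dual_space X. evaluation x f \<in> ball 0 e}"
    have "openin (topo dual) ?V"
      by (rule bidual_preimage[OF evaluation_bidual open_ball])
    moreover have "vzero dual \<in> ?V"
      using lc_closed_dual e by (simp add: evaluation_def lc_closed_def topspace_strong_dual)
    ultimately have "absorbs dual ?V H" using H by (simp add: lc_bounded_def)
    then obtain r where r: "0 < r" "\<And>c. r \<le> cmod c \<Longrightarrow> H \<subseteq> vscale dual c ` ?V"
      unfolding absorbs_def by blast
    have "x \<in> s c ` ?T" if c: "r \<le> cmod c" for c
    proof -
      have c0: "c \<noteq> 0" using r(1) c by auto
      have "s (1 / c) x \<in> ?T"
      proof clarify
        fix f assume f: "f \<in> H"
        obtain v where v: "v \<in> ?V" "f = vscale dual c v" using r(2)[OF c] f by blast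
        then have "cmod (v x) < e" by (auto simp: evaluation_def)
        moreover have "f (s (1 / c) x) = v x" using v c0 dual_scale[of v "1 / c" x] by simp
        ultimately show "cmod (f (s (1 / c) x)) \<le> e" by simp
      qed
      moreover have "x = s c (s (1 / c) x)" using c0 by simp
      ultimately show ?thesis by blast
    qed
    with r(1) show ?thesis unfolding absorbs_def by auto
  qed
  show ?thesis unfolding barrel_def using closed convex balanced absorbing by simp
qed

text \<open>A neighbourhood in the bidual is governed by a strongly bounded \<open>H\<close>. Its
  prepolar is a barrel, hence a neighbourhood of zero, and linearity moves it to any point. The
  radius \<open>e / 2\<close> turns the weak inequality of the barrel into a strict one.\<close>

lemma evaluation_continuous:
  assumes "barrelled X"
  shows "continuous_map (topo X) (topo (strong_dual dual)) evaluation"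
proof (rule continuous_map_algI)
  fix x show "evaluation x \<in> carr (strong_dual dual)" by (simp add: topspace_strong_dual evaluation_bidual)
next
  fix W x assume "openin (topo (strong_dual dual)) W" "evaluation x \<in> W"
  then obtain H e where H: "lc_bounded dual H" "0 < e"
    "{\<Psi> \<in> dual_space dual. \<forall>f\<in>H. cmod (\<Psi> f - evaluation x f) < e} \<subseteq> W"
    unfolding openin_strong_dual strong_open_def by meson
  have HX: "f \<in> dual_space X" if "f \<in> H" for f
    using H(1) that by (auto simp: lc_bounded_def topspace_strong_dual)
  have "barrel X {x. \<forall>f\<in>H. cmod (f x) \<le> e / 2}" by (rule polar_barrel[OF H(1)]) (use H(2) in simp)
  then obtain U where "openin (topo X) U" "0 \<in> U" "U \<subseteq> {x. \<forall>f\<in>H. cmod (f x) \<le> e / 2}"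
    using assms unfolding barrelled_def by force
  then obtain l r where r: "0 < r" "\<And>z f. p l z < r \<Longrightarrow> f \<in> H \<Longrightarrow> cmod (f z) \<le> e / 2"
    unfolding openin_alg by fastforce
  have "evaluation y \<in> W" if y: "p l (y - x) < r" for y
  proof -
    have "cmod (evaluation y f - evaluation x f) < e" if f: "f \<in> H" for f
      using r(2)[OF y f] H(2) HX[OF f] by (simp add: evaluation_def dual_diff)
    then show ?thesis using H(3) evaluation_bidual by blast
  qed
  with r(1) show "\<exists>l r. 0 < r \<and> (\<forall>y. p l (y - x) < r \<longrightarrow> evaluation y \<in> W)" by blast
qed

text \<open>A bound for \<open>p l\<close> on a bounded set bounds all these functionals there at
  once. The resulting neighbourhoods in the bidual are those that recover the seminorm
  \<open>p l\<close>.\<close>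

lemma equicontinuous_bounded:
  "lc_bounded dual {f \<in> dual_space X. \<forall>x. cmod (f x) \<le> p l x}" (is "lc_bounded dual ?H")
  unfolding lc_bounded_def
proof (intro conjI allI impI)
  show "?H \<subseteq> carr dual" by (auto simp: topspace_strong_dual)
  fix V assume "openin (topo dual) V \<and> vzero dual \<in> V"
  then obtain B e where B: "lc_bounded X B" "0 < e" "{g \<in> dual_space X. \<forall>x\<in>B. cmod (g x) < e} \<subseteq> V"
    unfolding openin_strong_dual strong_open_def by fastforce
  obtain M where M: "\<And>x. x \<in> B \<Longrightarrow> p l x \<le> M" using B(1) unfolding lc_bounded_alg by blast
  have R: "0 < (\<bar>M\<bar> + 1) / e" using B(2) by simp
  have "?H \<subseteq> vscale dual c ` V" if c: "(\<bar>M\<bar> + 1) / e \<le> cmod c" for c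
  proof
    fix f assume f: "f \<in> ?H"
    have c0: "0 < cmod c" using c R by linarith
    have "cmod (1 / c * f x) < e" if x: "x \<in> B" for x
    proof -
      have "cmod (f x) \<le> p l x" using f by simp
      then have "cmod (f x) < e * cmod c" using c B(2) M[OF x] by (simp add: field_simps)
      then show ?thesis using c0 by (simp add: norm_mult norm_divide field_simps)
    qed
    moreover have "(\<lambda>x. 1 / c * f x) \<in> dual_space X"
      using f by (intro dual_space_scale) simp
    ultimately have "(\<lambda>x. 1 / c * f x) \<in> V" using B(3) by blast
    moreover have "f = vscale dual c (\<lambda>x. 1 / c * f x)" using c0 by auto
    ultimately show "f \<in> vscale dual c ` V" by blast
  qed
  with R show "absorbs dual V ?H" unfolding absorbs_def by blast
qed

lemma evaluation_surjective:
  assumes montel: "montel X" and \<Phi>: "\<Phi> \<in> dual_space dual"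
  shows "\<exists>x. \<Phi> = evaluation x"
proof -
  have "openin (topo dual) {f \<in> dual_space X. \<Phi> f \<in> ball 0 1}"
    by (rule bidual_preimage[OF \<Phi> open_ball])
  moreover note dual_space_zero
  moreover have "\<Phi> (\<lambda>x. 0) = 0" using bidual_scale[OF \<Phi> dual_space_zero, of 0] by simp
  ultimately have "\<exists>B e. lc_bounded X B \<and> 0 < e \<and>
      {g \<in> dual_space X. \<forall>x\<in>B. cmod (g x - 0) < e} \<subseteq> {f \<in> dual_space X. \<Phi> f \<in> ball 0 1}"
    unfolding openin_strong_dual strong_open_def by (elim conjE ballE[of _ _ "\<lambda>x. 0"]) simp_all
  then obtain B e where B: "lc_bounded X B" and e: "0 < e"
    and sub: "{g \<in> dual_space X. \<forall>x\<in>B. cmod (g x - 0) < e} \<subseteq> {f \<in> dual_space X. \<Phi> f \<in> ball 0 1}"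
    by blast
  have \<Phi>1: "cmod (\<Phi> f) < 1" if "f \<in> dual_space X" "\<And>x. x \<in> B \<Longrightarrow> cmod (f x) < e" for f
    using subsetD[OF sub, of f] that by simp
  \<comment> \<open>The bounds are taken nonnegative so that \<open>K\<close> contains 0 even if
    \<open>B\<close> is empty.\<close>
  have "\<forall>l. \<exists>M\<ge>0. \<forall>x\<in>B. p l x \<le> M"
    using B unfolding lc_bounded_alg by (meson max.cobounded1 max.coboundedI2)
  then obtain M where M: "\<And>l. 0 \<le> M l" "\<And>l x. x \<in> B \<Longrightarrow> p l x \<le> M l" by metis
  \<comment> \<open>An intersection of seminorm balls is closed, convex and balanced by
    construction. The factor \<open>2 / e\<close> puts \<open>2 / e\<close> times \<open>B\<close>
    inside \<open>K\<close>, so a bound \<open>C\<close> for \<open>f\<close> on \<open>K\<close>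
    gives \<open>e * C / 2\<close> on \<open>B\<close>.\<close>
  define K where "K = {x. \<forall>l. p l x \<le> 2 / e * M l}"
  have "closedin (topo X) K"
  proof -
    have "openin (topo X) (- K)" unfolding openin_alg
    proof
      fix x assume "x \<in> - K"
      then obtain l where l: "2 / e * M l < p l x" by (auto simp: K_def not_le)
      have "y \<in> - K" if "p l (y - x) < p l x - 2 / e * M l" for y
      proof -
        have "2 / e * M l < p l y" using that p_triangle[of l x y] p_diff_commute[of l x y] by linarith
        then show ?thesis by (auto simp: K_def not_le)
      qed
      with l show "\<exists>l r. 0 < r \<and> (\<forall>y. p l (y - x) < r \<longrightarrow> y \<in> - K)"
        by (intro exI[of _ l] exI[of _ "p l x - 2 / e * M l"]) simp
    qed
    then show ?thesis by (simp add: closedin_def Compl_eq_Diff_UNIV)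
  qed
  moreover have "lc_bounded X K" by (auto simp: lc_bounded_alg K_def)
  ultimately have K: "compactin (topo X) K" using montel by (simp add: montel_def)
  have K0: "0 \<in> K" using M(1) e by (simp add: K_def)
  have K_scale: "s c x \<in> K" if "x \<in> K" "cmod c \<le> 1" for c x
  proof -
    have "p l (s c x) \<le> 2 / e * M l" for l
      using mult_right_mono[OF that(2) p_nonneg, of l x] that(1) by (simp add: p_scale K_def) (meson order_trans)
    then show ?thesis by (simp add: K_def)
  qed
  have K_convex: "x + s (complex_of_real t) (y - x) \<in> K" if "x \<in> K" "y \<in> K" "0 \<le> t" "t \<le> 1" for x y t
  proof -
    have "p l (x + s (complex_of_real t) (y - x)) \<le> 2 / e * M l" for l
    proof -
      have *: "x + s (complex_of_real t) (y - x) = s (complex_of_real (1 - t)) x + s (complex_of_real t) y"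
        by (simp add: algebra_simps)
      have "p l (x + s (complex_of_real t) (y - x)) \<le> (1 - t) * p l x + t * p l y"
        unfolding * using p_add[of l "s (complex_of_real (1 - t)) x" "s (complex_of_real t) y"] that
        by (simp add: p_scale del: of_real_diff)
      also have "\<dots> \<le> (1 - t) * (2 / e * M l) + t * (2 / e * M l)"
        using that by (intro add_mono mult_left_mono) (auto simp: K_def)
      also have "\<dots> = 2 / e * M l" unfolding left_diff_distrib by simp
      finally show ?thesis .
    qed
    then show ?thesis by (simp add: K_def)
  qed
  have \<Phi>_le: "cmod (\<Phi> f) \<le> C" if f: "f \<in> dual_space X" and C: "\<And>x. x \<in> K \<Longrightarrow> cmod (f x) \<le> C" for f C
  proof (rule field_le_epsilon)
    \<comment> \<open>\<open>C\<close> may be zero, so \<open>f\<close> is normalized by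
      \<open>C + d\<close> with an arbitrarily small \<open>d\<close>.\<close>
    fix d :: real assume d: "0 < d"
    have "0 \<le> C" using C[OF K0] by (simp add: dual_zero[OF f])
    then have t: "0 < C + d" using d by simp
    let ?c = "complex_of_real (1 / (C + d))"
    have "cmod (?c * f x) < e" if x: "x \<in> B" for x
    proof -
      have "s (complex_of_real (2 / e)) x \<in> K" using M(2)[OF x] e by (auto simp: K_def p_scale norm_divide field_simps)
      then have "2 / e * cmod (f x) \<le> C" using C[of "s (complex_of_real (2 / e)) x"] e by (simp add: dual_scale[OF f] norm_mult norm_divide)
      then have "2 * cmod (f x) \<le> e * C" using e by (simp add: field_simps)
      also have "\<dots> < e * (C + d)" using d e by simp
      finally have "cmod (f x) < e * (C + d)" using norm_ge_zero[of "f x"] by linarith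
      then show ?thesis using t by (simp add: norm_mult norm_divide field_simps del: of_real_add)
    qed
    then have "cmod (\<Phi> (\<lambda>x. ?c * f x)) < 1"
      by (intro \<Phi>1 dual_space_scale[OF f])
    then show "cmod (\<Phi> f) \<le> C + d"
      using t unfolding bidual_scale[OF \<Phi> f]
      by (simp add: norm_mult norm_divide field_simps del: of_real_add)
  qed
  text \<open>A point of \<open>K\<close> minimizing the Euclidean distance between its values on \<open>F\<close> and those
    of \<open>\<Phi>\<close> attains them: otherwise the combination \<open>g\<close> of \<open>F\<close> along the residual \<open>v\<close> would
    violate \<open>\<Phi>_le\<close>.\<close>
  have finite_match: "\<exists>x\<in>K. \<forall>f\<in>F. f x = \<Phi> f" if F: "finite F" "F \<subseteq> dual_space X" for F
  proof -
    have FX: "f \<in> dual_space X" if "f \<in> F" for f using F(2) that by blast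
    define d where "d x = (\<Sum>f\<in>F. (cmod (\<Phi> f - f x))\<^sup>2)" for x
    have "continuous_map (topo X) euclideanreal d" unfolding d_def
      using dual_continuous[OF FX] F(1) by (intro continuous_intros) auto
    then have "compact (d ` K)"
      using image_compactin[OF K, of euclideanreal d] by simp
    then obtain x where x: "x \<in> K" "\<And>y. y \<in> K \<Longrightarrow> d x \<le> d y"
      using compact_attains_inf[of "d ` K"] K0 by auto
    define v where "v f = \<Phi> f - f x" for f
    define g where "g = (\<lambda>z. \<Sum>f\<in>F. cnj (v f) * f z)"
    have g: "g \<in> dual_space X" unfolding g_def by (rule dual_sum_closed[OF FX])
    have d: "d x = (\<Sum>f\<in>F. (cmod (v f))\<^sup>2)" by (simp add: d_def v_def)
    \<comment> \<open>First order optimality: moving from \<open>x\<close> towards \<open>y\<close>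
      inside the convex \<open>K\<close> cannot decrease \<open>d\<close>. Expanding the square,
      dividing by \<open>t\<close> and letting \<open>t\<close> tend to 0 leaves the claim.\<close>
    have le: "Re (g y) \<le> Re (g x)" if y: "y \<in> K" for y
    proof -
      let ?S = "\<Sum>f\<in>F. (cmod (f (y - x)))\<^sup>2"
      have sq: "(cmod (a - complex_of_real t * b))\<^sup>2 = (cmod a)\<^sup>2 - 2 * t * Re (cnj a * b) + t\<^sup>2 * (cmod b)\<^sup>2" for a b t
        unfolding cmod_power2 by (simp add: power2_eq_square algebra_simps)
      have "2 * Re (g (y - x)) \<le> t * ?S" if t: "0 < t" "t \<le> 1" for t
      proof -
        have "d (x + s (complex_of_real t) (y - x)) = (\<Sum>f\<in>F. (cmod (v f - complex_of_real t * f (y - x)))\<^sup>2)"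
          unfolding d_def by (intro sum.cong) (auto simp: v_def dual_add[OF FX] dual_scale[OF FX] diff_diff_eq)
        also have "\<dots> = d x - 2 * t * Re (g (y - x)) + t\<^sup>2 * ?S"
          unfolding sq sum.distrib sum_subtractf d g_def Re_sum by (simp only: sum_distrib_left)
        finally have "2 * t * Re (g (y - x)) \<le> t\<^sup>2 * ?S"
          using x(2)[OF K_convex[OF x(1) y, of t]] t by simp
        then show ?thesis using t by (simp add: power2_eq_square)
      qed
      note small = this
      have "2 * Re (g (y - x)) \<le> 0 + r" if r: "0 < r" for r
      proof -
        have S: "0 \<le> ?S" by (intro sum_nonneg) simp
        \<comment> \<open>This \<open>t\<close> is positive, at most 1, and makes the quadratic
          remainder at most \<open>r\<close>; the summand 1 covers \<open>?S = 0\<close>.\<close>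
        have "min 1 (r / (?S + 1)) * ?S \<le> r / (?S + 1) * ?S" using S by (intro mult_right_mono) auto
        also have "\<dots> \<le> r" using S r by (simp add: field_simps)
        finally show ?thesis using small[of "min 1 (r / (?S + 1))"] S r by simp
      qed
      then have "2 * Re (g (y - x)) \<le> 0" by (rule field_le_epsilon)
      then show ?thesis by (simp add: dual_diff[OF g])
    qed
    \<comment> \<open>\<open>K\<close> is balanced, so \<open>y\<close> may be rotated until
      \<open>g y\<close> is real and nonnegative; the maximum of the real part then bounds the
      modulus.\<close>
    have "cmod (g y) \<le> Re (g x)" if y: "y \<in> K" for y
    proof (cases "g y = 0")
      case True then show ?thesis using le[OF K0] by (simp add: dual_zero[OF g])
    next
      case False
      define w where "w = cnj (g y) / cmod (g y)"
      have w: "cmod w \<le> 1" using False by (simp add: w_def norm_divide)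
      have "w * g y = cmod (g y)" using False
        by (simp add: w_def complex_norm_square[symmetric] mult.commute power2_eq_square)
      then have "cmod (g y) = Re (g (s w y))" by (simp add: dual_scale[OF g])
      also have "\<dots> \<le> Re (g x)" by (rule le[OF K_scale[OF y w]])
      finally show ?thesis .
    qed
    then have "cmod (\<Phi> g) \<le> Re (g x)" by (rule \<Phi>_le[OF g])
    \<comment> \<open>With conjugated residuals as coefficients, \<Phi> exceeds evaluation at
      \<open>x\<close> on \<open>g\<close> by exactly the squared distance \<open>d x\<close>,
      whereas the bound just proved leaves no room for a positive excess.\<close>
    moreover have "\<Phi> g = d x + g x"
    proof -
      have "\<Phi> g = (\<Sum>f\<in>F. cnj (v f) * \<Phi> f)" unfolding g_def by (rule bidual_sum[OF \<Phi> FX])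
      also have "\<dots> = (\<Sum>f\<in>F. complex_of_real ((cmod (v f))\<^sup>2) + cnj (v f) * f x)"
        unfolding complex_norm_square by (intro sum.cong refl) (simp add: v_def algebra_simps)
      finally show ?thesis by (simp add: sum.distrib d g_def)
    qed
    ultimately have "d x \<le> 0" using complex_Re_le_cmod[of "\<Phi> g"] by simp
    then have "v f = 0" if "f \<in> F" for f
      using sum_nonneg_0[of F "\<lambda>f. (cmod (v f))\<^sup>2" f] F(1) that by (simp add: d sum_nonneg order_antisym)
    then show ?thesis using x(1) by (auto simp: v_def)
  qed
  let ?U = "(\<lambda>f. {x. f x = \<Phi> f}) ` dual_space X"
  \<comment> \<open>Finite agreement is the finite intersection property for the closed sets on
    which \<open>f\<close> takes the value \<open>\<Phi> f\<close>.\<close>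
  have "K \<inter> \<Inter> ?U \<noteq> {}"
  proof -
    have "closedin (topo X) C" if C: "C \<in> ?U" for C
    proof -
      obtain f where f: "f \<in> dual_space X" "C = {x. f x = \<Phi> f}" using C by blast
      then show ?thesis
        using closedin_continuous_map_preimage[OF dual_continuous[OF f(1)], of "{\<Phi> f}"] by simp
    qed
    moreover have "K \<inter> \<Inter> G \<noteq> {}" if G: "finite G" "G \<subseteq> ?U" for G
    proof -
      obtain F where F: "F \<subseteq> dual_space X" "finite F" "G = (\<lambda>f. {x. f x = \<Phi> f}) ` F"
        using finite_subset_image[OF G] by blast
      then show ?thesis using finite_match[OF F(2,1)] by blast
    qed
    ultimately show ?thesis
      using K[unfolded compactin_fip, THEN conjunct2, rule_format, of ?U] by simp
  qed
  then obtain x where "\<And>f. f \<in> dual_space X \<Longrightarrow> f x = \<Phi> f" by blast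
  then have "\<Phi> = evaluation x"
    using bidual_extensional[OF \<Phi>] by (auto simp: evaluation_def extensional_def)
  then show ?thesis by blast
qed

text \<open>A functional dominated by \<open>p l\<close> and attaining it at \<open>y - x\<close>
  shows that closeness of \<open>evaluation y\<close> to \<open>evaluation x\<close> on
  \<open>?H\<close> forces \<open>p l (y - x) < r\<close>. Surjectivity is what makes every nearby
  element of the bidual an evaluation.\<close>

lemma evaluation_open:
  assumes surj: "\<And>\<Phi>. \<Phi> \<in> dual_space dual \<Longrightarrow> \<exists>x. \<Phi> = evaluation x"
  shows "open_map (topo X) (topo (strong_dual dual)) evaluation"
  unfolding open_map_def openin_strong_dual strong_open_def
proof (intro allI impI conjI ballI)
  fix U \<Phi> assume U: "openin (topo X) U" and "\<Phi> \<in> evaluation ` U"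
  then obtain x where x: "x \<in> U" "\<Phi> = evaluation x" by blast
  then obtain l r where r: "0 < r" "\<And>y. p l (y - x) < r \<Longrightarrow> y \<in> U" using U unfolding openin_alg by blast
  let ?H = "{f \<in> dual_space X. \<forall>x. cmod (f x) \<le> p l x}"
  have "{\<Psi> \<in> dual_space dual. \<forall>f\<in>?H. cmod (\<Psi> f - \<Phi> f) < r} \<subseteq> evaluation ` U"
  proof safe
    fix \<Psi> assume \<Psi>: "\<Psi> \<in> dual_space dual" "\<forall>f\<in>?H. cmod (\<Psi> f - \<Phi> f) < r"
    obtain y where y: "\<Psi> = evaluation y" using surj[OF \<Psi>(1)] by blast
    obtain f where f: "f \<in> dual_space X" "\<And>z. cmod (f z) \<le> p l z" "f (y - x) = complex_of_real (p l (y - x))"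
      using norming_functional by metis
    have "cmod (f (y - x)) < r" using \<Psi>(2) f(1,2) x(2) y by (simp add: evaluation_def dual_diff)
    then have "p l (y - x) < r" using f(3) p_nonneg[of l "y - x"] by simp
    then show "\<Psi> \<in> evaluation ` U" using r(2) y by blast
  qed
  with equicontinuous_bounded[of l] r(1)
  show "\<exists>B e. lc_bounded dual B \<and> 0 < e \<and>
      {\<Psi> \<in> dual_space dual. \<forall>f\<in>B. cmod (\<Psi> f - \<Phi> f) < e} \<subseteq> evaluation ` U"
    by blast
qed (use evaluation_bidual in auto)

lemma montel_reflexive:
  assumes montel: "montel X"
  shows "bimod_isomorphic X (strong_dual dual)"
proof -
  have surj: "\<exists>x. \<Phi> = evaluation x" if "\<Phi> \<in> dual_space dual" for \<Phi>
    by (rule evaluation_surjective[OF montel that])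
  have "homeomorphic_map (topo X) (topo (strong_dual dual)) evaluation"
  proof (rule bijective_open_imp_homeomorphic_map)
    show "continuous_map (topo X) (topo (strong_dual dual)) evaluation"
      using evaluation_continuous montel by (simp add: montel_def)
    show "open_map (topo X) (topo (strong_dual dual)) evaluation" by (rule evaluation_open[OF surj])
    show "evaluation ` topspace (topo X) = topspace (topo (strong_dual dual))"
      using surj evaluation_bidual by (auto simp: topspace_strong_dual)
    show "inj_on evaluation (topspace (topo X))" using evaluation_inj by simp
  qed
  moreover have "lc_closed X" by (rule lc_closed_alg_bimod[OF frechet])
  ultimately have "lc_iso evaluation X (strong_dual dual)"
    by (auto simp: lc_iso_def strong_dual_def[of dual] topspace_strong_dual evaluation_def
        dual_add dual_scale dual_zero Let_def)
  \<comment> \<open>The actions on the bidual feed these translated functionals to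
    \<open>evaluation x\<close>, which is restricted to the dual; on them both sides reduce to
    \<open>f (a * x)\<close> or \<open>f (x * a)\<close>.\<close>
  moreover have "(\<lambda>x. f (a * x)) \<in> dual_space X" "(\<lambda>x. f (x * a)) \<in> dual_space X"
    if "f \<in> dual_space X" for f a
    using lc_bimod_carr[OF lc_bimod_strong_dual[OF lc_bimod_alg], of f a] that
    by (simp_all add: topspace_strong_dual)
  ultimately have "bimod_iso evaluation X (strong_dual dual)"
    unfolding bimod_iso_def using lc_bimod_alg
    by (auto simp: strong_dual_def[of dual] topspace_strong_dual evaluation_def Let_def)
  then show ?thesis by (auto simp: bimod_isomorphic_def)
qed

end

theorem proposition3p3:
  fixes s :: "complex \<Rightarrow> 'a::ring \<Rightarrow> 'a" and p :: "nat \<Rightarrow> 'a \<Rightarrow> real"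
    and j :: "'a \<Rightarrow> 'u" and c :: "nat \<Rightarrow> ('u \<Rightarrow> complex) \<Rightarrow> 'u" and n :: nat
  assumes "frechet_algebra s p"
    and "montel (alg_bimod s p)"
    and "1 \<le> n"
    and "dual_coding j c (alg_bimod s p) (n + 2)"
    and "weakly_amenable j c (n + 2) (alg_bimod s p)"
  shows "weakly_amenable j c n (alg_bimod s p)"
proof -
  interpret frechet_alg s p by unfold_locales (rule assms(1))
  \<comment> \<open>At \<open>k = n\<close> the bound in \<open>iter_dual_periodic\<close> is met
    with equality: exactly the \<open>n + 2\<close> coded levels are used.\<close>
  have iso: "bimod_isomorphic (iter_dual j c (alg_bimod s p) n) (iter_dual j c (alg_bimod s p) (n + 2))"
    by (rule iter_dual_periodic[OF lc_bimod_alg assms(4) montel_reflexive[OF assms(2)]]) simp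
  show ?thesis
    unfolding weakly_amenable_def
    using inner_derivations_transfer[OF iso _ carr_alg] assms(5) unfolding weakly_amenable_def by blast
qed

end
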